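(* For every integer $r \geqslant 1$, $$\mathsf{D}(C^r_n) \sim rn \quad \text{as } n \to +\infty,$$ i.e. $\mathsf{D}(C^r_n)/(rn) \to 1$ as $n \to +\infty$.
   Context: For an integer $n \geqslant 1$, $C_n$ denotes the cyclic group of order $n$ and $C_n^r$ the direct sum of $r$ copies of $C_n$. For a finite Abelian group $G$, a sequence over $G$ is a finite (unordered, repetitions allowed) sequence of elements of $G$; it is zero-sum if the sum of its elements is $0$. The Davenport constant $\mathsf{D}(G)$ is the smallest integer $t \geqslant 1$ such that every sequence over $G$ of length at least $t$ contains a non-empty zero-sum subsequence. *)

theory Defs
  imports Complex_Main "HOL-Library.Multiset" "HOL-Algebra.Product_Groups"
    "HOL-Algebra.Multiplicative_Group"
begin

text \<open>
  Groups are written multiplicatively, as in HOL-Algebra; so the ``sum'' of a sequence is a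
  \<open>finprod\<close> and ``zero-sum'' means that it equals \<open>\<one>\<close>.
  Sequences (unordered, with repetitions) are multisets, their subsequences are sub-multisets.
\<close>

definition seq_sum :: "('a, 'b) monoid_scheme \<Rightarrow> 'a multiset \<Rightarrow> 'a" where
  "seq_sum G S = finprod G (\<lambda>g. g [^]\<^bsub>G\<^esub> count S g) (set_mset S)"

definition zero_sum :: "('a, 'b) monoid_scheme \<Rightarrow> 'a multiset \<Rightarrow> bool" where
  "zero_sum G S \<longleftrightarrow> seq_sum G S = \<one>\<^bsub>G\<^esub>"

definition forces_zero_sum :: "('a, 'b) monoid_scheme \<Rightarrow> nat \<Rightarrow> bool" where
  "forces_zero_sum G t \<longleftrightarrow>
     (\<forall>S. set_mset S \<subseteq> carrier G \<and> size S \<ge> t \<longrightarrow>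
        (\<exists>T. T \<subseteq># S \<and> T \<noteq> {#} \<and> zero_sum G T))"

definition davenport :: "('a, 'b) monoid_scheme \<Rightarrow> nat" where
  "davenport G = (LEAST t. t \<ge> 1 \<and> forces_zero_sum G t)"

text \<open>
  \<open>Cyc_pow n r\<close> is $C_n^r$. It is meant for \<open>n \<ge> 1\<close>:
  \<open>integer_mod_group 0\<close> is the infinite cyclic group.
\<close>

definition Cyc_pow :: "nat \<Rightarrow> nat \<Rightarrow> (nat \<Rightarrow> int) monoid" where
  "Cyc_pow n r = product_group {..<r} (\<lambda>_. integer_mod_group n)"

lemma comm_group_Cyc_pow: "comm_group (Cyc_pow n r)"
  unfolding Cyc_pow_def
proof (rule group.group_comm_groupI)
  show "group (product_group {..<r} (\<lambda>_. integer_mod_group n))"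
    by (simp add: product_group)
qed (auto simp: fun_eq_iff add.commute)

lemma finite_Cyc_pow: "n \<ge> 1 \<Longrightarrow> finite (carrier (Cyc_pow n r))"
  by (simp add: Cyc_pow_def carrier_integer_mod_group finite_PiE)

text \<open>The minimum defining \<open>davenport G\<close> is attained for every finite Abelian group.\<close>

lemma davenport_wf:
  assumes "comm_group G" "finite (carrier G)"
  shows "davenport G \<ge> 1" "forces_zero_sum G (davenport G)"
proof -
  interpret comm_group G by fact
  let ?q = "order G"
  have q: "?q > 0" using assms(2) order_gt_0_iff_finite by blast
  have "forces_zero_sum G (?q * ?q)"
    unfolding forces_zero_sum_def
  proof (intro allI impI)
    fix S assume S: "set_mset S \<subseteq> carrier G \<and> size S \<ge> ?q * ?q"
    have "\<exists>g\<in>carrier G. count S g \<ge> ?q"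
    proof (rule ccontr)
      assume *: "\<not> ?thesis"
      have "size S = (\<Sum>g\<in>set_mset S. count S g)"
        by (rule size_multiset_overloaded_eq)
      also have "\<dots> \<le> (\<Sum>g\<in>carrier G. count S g)"
        using S assms(2) by (intro sum_mono2) auto
      also have "\<dots> < (\<Sum>g\<in>carrier G. ?q)"
        using * assms(2) by (intro sum_strict_mono) auto
      finally show False using S by (simp add: order_def)
    qed
    then obtain g where g: "g \<in> carrier G" "count S g \<ge> ?q" by blast
    have "zero_sum G (replicate_mset ?q g)"
      using g q pow_order_eq_1[OF g(1)]
      by (simp add: zero_sum_def seq_sum_def)
    moreover have "replicate_mset ?q g \<subseteq># S"
      using g by (simp add: count_le_replicate_mset_subset_eq)
    ultimately show "\<exists>T. T \<subseteq># S \<and> T \<noteq> {#} \<and> zero_sum G T"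
      using q by (metis size_empty size_replicate_mset less_irrefl)
  qed
  then have "?q * ?q \<ge> 1 \<and> forces_zero_sum G (?q * ?q)" using q by simp
  then have "davenport G \<ge> 1 \<and> forces_zero_sum G (davenport G)"
    unfolding davenport_def by (rule LeastI)
  then show "davenport G \<ge> 1" "forces_zero_sum G (davenport G)" by auto
qed

end

theory Submission
  imports Defs "HOL-Library.Disjoint_Sets" "HOL-Number_Theory.Cong" "HOL-Real_Asymp.Real_Asymp"
begin

text \<open>
  Let \<open>q\<close> be the largest prime power dividing \<open>n = m q\<close>; since \<open>n \<le> q\<^sup>q\<close>, it tends to infinity
  with \<open>n\<close>. Splitting off short zero-sum blocks modulo \<open>m\<close> and then using Olson's theorem
  \<open>D(C\<^sub>q\<^sup>r) \<le> r (q - 1) + 1\<close> for the block sums gives \<open>D(C\<^sub>n\<^sup>r) \<le> m (r (q - 1) + 1) + \<eta>(C\<^sub>m\<^sup>r)\<close>, where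
  \<open>\<eta>(C\<^sub>m\<^sup>r)\<close> is the length that forces a nonempty zero-sum subsequence of length at most \<open>m\<close>.
  So it is enough that \<open>\<eta>(C\<^sub>m\<^sup>r) = o(n)\<close>. The same splitting reduces this to primes \<open>p \<le> q\<close>, for
  which \<open>\<eta>(C\<^sub>p\<^sup>r) = O(p (log p)\<^sup>r)\<close> suffices, a weak form of a theorem of Alon and Dubiner with
  a simpler proof. By induction on \<open>r\<close> one may assume that no affine hyperplane contains many
  elements of the sequence. A Fourier estimate then shows that any set \<open>Y\<close> of at most half of
  the group grows by a factor \<open>1 + c (log p) / p\<close> when it is united with its translate by a
  suitable difference of two elements. Hence the sums of about \<open>p / 2\<close> elements fill more than
  half of the group, and two such families together represent every element.
\<close>

section \<open>Characters and expansion in elementary abelian groups\<close>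

definition echar :: "nat \<Rightarrow> int \<Rightarrow> complex" where
  "echar p t = cis (2 * pi * of_int t / of_nat p)"

text \<open>Reduced representatives of the elements of \<open>C_p^J\<close>. They also index its
  characters: \<open>u\<close> stands for the map sending \<open>x\<close> to
  \<open>echar p (dotp J u x)\<close>.\<close>

definition vecs :: "nat \<Rightarrow> 'j set \<Rightarrow> ('j \<Rightarrow> int) set" where
  "vecs p J = J \<rightarrow>\<^sub>E {0..<int p}"

definition dotp :: "'j set \<Rightarrow> ('j \<Rightarrow> int) \<Rightarrow> ('j \<Rightarrow> int) \<Rightarrow> int" where
  "dotp J u x = (\<Sum>j\<in>J. u j * x j)"

text \<open>The shift \<open>x\<close> may be any integer vector, such as a difference or a multiple
  of given elements; only the result is reduced.\<close>

definition translate :: "nat \<Rightarrow> 'j set \<Rightarrow> ('j \<Rightarrow> int) \<Rightarrow> ('j \<Rightarrow> int) \<Rightarrow> 'j \<Rightarrow> int" where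
  "translate p J x y = (\<lambda>j\<in>J. (y j + x j) mod int p)"

lemma echar_0 [simp]: "echar p 0 = 1"
  by (simp add: echar_def)

lemma norm_echar [simp]: "norm (echar p t) = 1"
  by (simp add: echar_def)

lemma echar_add: "echar p (s + t) = echar p s * echar p t"
  by (simp add: echar_def cis_mult ring_distribs add_divide_distrib)

lemma echar_uminus: "echar p (- t) = cnj (echar p t)"
  by (simp add: echar_def cis_cnj)

lemma echar_sum: "echar p (sum f A) = (\<Prod>i\<in>A. echar p (f i))"
  by (induction A rule: infinite_finite_induct) (auto simp: echar_add)

lemma echar_of_nat_mult: "echar p (int k * t) = echar p t ^ k"
  by (induction k) (auto simp: echar_add algebra_simps)

lemma echar_eq_1_iff:
  assumes "p > 0"
  shows "echar p t = 1 \<longleftrightarrow> int p dvd t"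
proof
  assume "echar p t = 1"
  then have "cos (2 * pi * of_int t / of_nat p) = 1"
    by (simp add: echar_def complex_eq_iff)
  then obtain k :: int where "2 * pi * of_int t / of_nat p = of_int k * 2 * pi"
    unfolding cos_one_2pi_int by blast
  then have "of_int t = (of_int (k * int p) :: real)"
    using assms by (simp add: field_simps)
  then have "t = k * int p" by linarith
  then show "int p dvd t" by simp
next
  assume "int p dvd t"
  then obtain k where "t = int p * k" by blast
  then have "echar p t = cis (2 * pi * of_int k)"
    using assms by (simp add: echar_def mult.assoc)
  then show "echar p t = 1" using cis_multiple_2pi[of "of_int k"] by (simp add: mult.assoc)
qed

lemma echar_mod:
  assumes "p > 0"
  shows "echar p (t mod int p) = echar p t"
proof -
  have "echar p t = echar p (t mod int p + (t div int p) * int p)" by simp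
  also have "\<dots> = echar p (t mod int p) * echar p ((t div int p) * int p)"
    by (rule echar_add)
  finally show ?thesis using echar_eq_1_iff[OF assms] by simp
qed

text \<open>Orthogonality in one coordinate: \<open>echar p t\<close> is a \<open>p\<close>-th root
  of unity, so its geometric sum over a full period vanishes unless it equals 1.\<close>

lemma sum_echar:
  assumes "p > 0"
  shows "(\<Sum>u\<in>{0..<int p}. echar p (u * t)) = (if int p dvd t then of_nat p else 0)"
proof -
  have "{0..<int p} = int ` {..<p}" by (simp add: image_int_atLeastLessThan lessThan_atLeast0)
  then have eq: "(\<Sum>u\<in>{0..<int p}. echar p (u * t)) = (\<Sum>k<p. echar p t ^ k)"
    by (simp add: sum.reindex echar_of_nat_mult)
  have "echar p t ^ p = 1"
    using echar_eq_1_iff[OF assms] by (simp flip: echar_of_nat_mult)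
  then show ?thesis
    using echar_eq_1_iff[OF assms, of t] by (auto simp: eq geometric_sum)
qed

lemma finite_vecs [simp]: "finite J \<Longrightarrow> finite (vecs p J)"
  by (simp add: vecs_def finite_PiE)

lemma card_vecs: "finite J \<Longrightarrow> card (vecs p J) = p ^ card J"
  by (simp add: vecs_def card_PiE)

text \<open>The sum over \<open>vecs p J\<close> factors into one geometric sum per coordinate,
  which gives the orthogonality of characters.\<close>

lemma sum_echar_dotp:
  assumes "p > 0" "finite J"
  shows "(\<Sum>u\<in>vecs p J. echar p (dotp J u x)) =
         (if \<forall>j\<in>J. int p dvd x j then of_nat (p ^ card J) else 0)"
proof -
  have "(\<Sum>u\<in>vecs p J. echar p (dotp J u x)) = (\<Sum>u\<in>vecs p J. \<Prod>j\<in>J. echar p (u j * x j))"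
    by (simp add: dotp_def echar_sum)
  also have "\<dots> = (\<Prod>j\<in>J. \<Sum>u\<in>{0..<int p}. echar p (u * x j))"
    unfolding vecs_def by (rule prod_sum_PiE [symmetric]) (use assms in auto)
  also have "\<dots> = (\<Prod>j\<in>J. if int p dvd x j then of_nat p else 0)"
    by (simp add: sum_echar[OF assms(1)])
  also have "\<dots> = (if \<forall>j\<in>J. int p dvd x j then of_nat (p ^ card J) else 0)"
    using assms by (auto simp: prod_zero_iff intro!: prod_zero)
  finally show ?thesis .
qed

lemma translate_in_vecs: "p > 0 \<Longrightarrow> translate p J x y \<in> vecs p J"
  by (auto simp: translate_def vecs_def)

lemma vecs_mod: "y \<in> vecs p J \<Longrightarrow> j \<in> J \<Longrightarrow> y j mod int p = y j"
  by (auto simp: vecs_def PiE_iff)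

lemma vecs_eqI:
  assumes "y \<in> vecs p J" "z \<in> vecs p J" "\<And>j. j \<in> J \<Longrightarrow> int p dvd y j - z j"
  shows "y = z"
proof (rule PiE_ext)
  show "y \<in> J \<rightarrow>\<^sub>E {0..<int p}" "z \<in> J \<rightarrow>\<^sub>E {0..<int p}" using assms by (auto simp: vecs_def)
  show "y j = z j" if "j \<in> J" for j
    using assms(3)[OF that] vecs_mod[OF assms(1) that] vecs_mod[OF assms(2) that]
    by (simp flip: mod_eq_dvd_iff)
qed

lemma translate_0: "y \<in> vecs p J \<Longrightarrow> translate p J (\<lambda>_. 0) y = y"
  by (auto simp: translate_def vecs_def PiE_iff extensional_def)

lemma translate_translate:
  "translate p J x (translate p J x' y) = translate p J (\<lambda>j. x' j + x j) y"
  by (auto simp: translate_def restrict_def mod_simps add.assoc)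

lemma translate_cong:
  "(\<And>j. j \<in> J \<Longrightarrow> x j = x' j) \<Longrightarrow> translate p J x y = translate p J x' y"
  by (auto simp: translate_def restrict_def)

lemma inj_on_translate: "inj_on (translate p J x) (vecs p J)"
proof (rule inj_onI)
  fix y z assume yz: "y \<in> vecs p J" "z \<in> vecs p J" "translate p J x y = translate p J x z"
  show "y = z"
  proof (rule vecs_eqI[OF yz(1,2)])
    fix j assume "j \<in> J"
    then have "(y j + x j) mod int p = (z j + x j) mod int p"
      using fun_cong[OF yz(3), of j] by (simp add: translate_def)
    then show "int p dvd y j - z j" by (simp add: mod_eq_dvd_iff)
  qed
qed

lemma card_translate: "Y \<subseteq> vecs p J \<Longrightarrow> card (translate p J x ` Y) = card Y"
  by (meson card_image inj_on_subset inj_on_translate)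

section \<open>Fourier transform of a set\<close>

definition fourier :: "nat \<Rightarrow> 'j set \<Rightarrow> ('j \<Rightarrow> int) set \<Rightarrow> ('j \<Rightarrow> int) \<Rightarrow> complex" where
  "fourier p J Y u = (\<Sum>y\<in>Y. echar p (dotp J u y))"

text \<open>Expanding the squared norm gives a sum over pairs \<open>y\<close>, \<open>z\<close> in
  \<open>Y\<close>. Summed over \<open>u\<close>, orthogonality keeps exactly the pairs with
  \<open>z = translate p J x y\<close>, and the intersection counts these.\<close>

lemma autocorrelation:
  assumes "p > 0" "finite J" "Y \<subseteq> vecs p J"
  shows "of_nat (p ^ card J * card (Y \<inter> translate p J x ` Y)) =
         (\<Sum>u\<in>vecs p J. of_real ((norm (fourier p J Y u))\<^sup>2) * echar p (dotp J u x))"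
proof -
  have fin: "finite Y" using assms finite_subset finite_vecs by blast
  have sq: "of_real ((norm (fourier p J Y u))\<^sup>2) * echar p (dotp J u x) =
     (\<Sum>y\<in>Y. \<Sum>z\<in>Y. echar p (dotp J u (\<lambda>j. y j + x j - z j)))" for u
  proof -
    have lin: "dotp J u y + - dotp J u z + dotp J u x = dotp J u (\<lambda>j. y j + x j - z j)" for y z
      by (simp add: dotp_def sum.distrib sum_subtractf ring_distribs)
    have "of_real ((norm (fourier p J Y u))\<^sup>2) = fourier p J Y u * cnj (fourier p J Y u)"
      by (rule complex_norm_square)
    also have "\<dots> = (\<Sum>y\<in>Y. \<Sum>z\<in>Y. echar p (dotp J u y) * echar p (- dotp J u z))"
      by (simp add: fourier_def sum_product echar_uminus)
    finally have "of_real ((norm (fourier p J Y u))\<^sup>2) * echar p (dotp J u x) =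
       (\<Sum>y\<in>Y. \<Sum>z\<in>Y. echar p (dotp J u y) * echar p (- dotp J u z)) * echar p (dotp J u x)"
      by simp
    also have "\<dots> = (\<Sum>y\<in>Y. \<Sum>z\<in>Y. echar p (dotp J u y + - dotp J u z + dotp J u x))"
      by (simp only: sum_distrib_right echar_add)
    also have "\<dots> = (\<Sum>y\<in>Y. \<Sum>z\<in>Y. echar p (dotp J u (\<lambda>j. y j + x j - z j)))"
      by (simp only: lin)
    finally show ?thesis .
  qed
  have "(\<Sum>u\<in>vecs p J. of_real ((norm (fourier p J Y u))\<^sup>2) * echar p (dotp J u x)) =
    (\<Sum>u\<in>vecs p J. \<Sum>y\<in>Y. \<Sum>z\<in>Y. echar p (dotp J u (\<lambda>j. y j + x j - z j)))"
    by (simp only: sq)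
  also have "\<dots> = (\<Sum>y\<in>Y. \<Sum>z\<in>Y. \<Sum>u\<in>vecs p J. echar p (dotp J u (\<lambda>j. y j + x j - z j)))"
    by (subst sum.swap) (intro sum.cong refl sum.swap)
  also have "\<dots> = (\<Sum>y\<in>Y. \<Sum>z\<in>Y. if z = translate p J x y then of_nat (p ^ card J) else 0)"
  proof (intro sum.cong refl)
    fix y z assume yz: "y \<in> Y" "z \<in> Y"
    have "(\<forall>j\<in>J. int p dvd y j + x j - z j) \<longleftrightarrow> z = translate p J x y"
    proof
      assume *: "\<forall>j\<in>J. int p dvd y j + x j - z j"
      have "translate p J x y = z"
      proof (rule vecs_eqI[of _ p J])
        show "translate p J x y \<in> vecs p J" by (rule translate_in_vecs[OF assms(1)])
        show "z \<in> vecs p J" using yz assms by blast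
        show "int p dvd translate p J x y j - z j" if "j \<in> J" for j
        proof -
          have "(y j + x j) mod int p = z j mod int p"
            using * that by (simp add: mod_eq_dvd_iff)
          then have "(y j + x j) mod int p mod int p = z j mod int p" by simp
          then show ?thesis using that by (simp only: mod_eq_dvd_iff translate_def restrict_apply')
        qed
      qed
      then show "z = translate p J x y" by simp
    next
      assume z: "z = translate p J x y"
      show "\<forall>j\<in>J. int p dvd y j + x j - z j"
      proof
        fix j assume "j \<in> J"
        then show "int p dvd y j + x j - z j" using z by (simp add: translate_def dvd_minus_mod)
      qed
    qed
    then show "(\<Sum>u\<in>vecs p J. echar p (dotp J u (\<lambda>j. y j + x j - z j))) =
       (if z = translate p J x y then of_nat (p ^ card J) else 0)"
      by (simp add: sum_echar_dotp[OF assms(1,2)])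
  qed
  also have "\<dots> = (\<Sum>y\<in>Y. if translate p J x y \<in> Y then of_nat (p ^ card J) else 0)"
    using fin by (simp add: sum.delta)
  also have "\<dots> = of_nat (p ^ card J) * of_nat (card {y\<in>Y. translate p J x y \<in> Y})"
    using fin by (simp add: sum.If_cases Int_def)
  also have "card {y\<in>Y. translate p J x y \<in> Y} = card (translate p J x ` {y\<in>Y. translate p J x y \<in> Y})"
    by (rule card_translate [symmetric]) (use assms in auto)
  also have "translate p J x ` {y\<in>Y. translate p J x y \<in> Y} = Y \<inter> translate p J x ` Y"
    by auto
  finally show ?thesis by simp
qed

text \<open>The autocorrelation identity for the zero shift, under which \<open>Y\<close> is its own
  translate.\<close>

lemma parseval:
  assumes "p > 0" "finite J" "Y \<subseteq> vecs p J"
  shows "(\<Sum>u\<in>vecs p J. (norm (fourier p J Y u))\<^sup>2) = real (p ^ card J * card Y)"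
proof -
  have "translate p J (\<lambda>_. 0) ` Y = Y"
    using assms(3) by (force simp: translate_0)
  then have "complex_of_nat (p ^ card J * card Y) = (\<Sum>u\<in>vecs p J. of_real ((norm (fourier p J Y u))\<^sup>2))"
    using autocorrelation[OF assms, of "\<lambda>_. 0"] by (simp add: dotp_def)
  also have "\<dots> = of_real (\<Sum>u\<in>vecs p J. (norm (fourier p J Y u))\<^sup>2)" by simp
  finally have "complex_of_real (real (p ^ card J * card Y)) =
     of_real (\<Sum>u\<in>vecs p J. (norm (fourier p J Y u))\<^sup>2)"
    by (simp only: of_real_of_nat_eq)
  then show ?thesis by (simp only: of_real_eq_iff)
qed

section \<open>Bounds for sums of characters\<close>

text \<open>With \<open>y = x / 2\<close>, the cosine is at least \<open>c = cos (pi / 4)\<close> on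
  \<open>[0, y]\<close>. Hence \<open>sin y\<close> is at least \<open>c * y\<close>, and the double
  angle formula gives \<open>sin x >= 2 * c * c * y = y\<close>.\<close>

lemma half_le_sin:
  assumes "0 \<le> x" "x \<le> pi / 2"
  shows "x / 2 \<le> sin x"
proof -
  define y where "y = x / 2"
  define c where "c = cos (pi / 4)"
  have c: "c > 0" "2 * c * c = 1" by (auto simp: c_def cos_45)
  have cos_ge: "c \<le> cos z" if "0 \<le> z" "z \<le> y" for z
    unfolding c_def using that assms by (intro cos_monotone_0_pi_le) (auto simp: y_def)
  have "sin 0 - c * 0 \<le> sin y - c * y"
  proof (rule DERIV_nonneg_imp_nondecreasing[where f = "\<lambda>x. sin x - c * x"])
    show "0 \<le> y" using assms by (simp add: y_def)
    show "\<exists>d. ((\<lambda>x. sin x - c * x) has_real_derivative d) (at z) \<and> 0 \<le> d" if "0 \<le> z" "z \<le> y" for z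
      using cos_ge[OF that] by (intro exI[of _ "cos z - c"]) (auto intro!: derivative_eq_intros)
  qed
  then have "(c * y) * c \<le> sin y * cos y"
    using c cos_ge[of y] assms sin_ge_zero[of y] by (intro mult_mono) (auto simp: y_def)
  moreover have "sin x = 2 * (sin y * cos y)" using sin_double[of y] by (simp add: y_def)
  moreover have "2 * ((c * y) * c) = (2 * c * c) * y" by (simp only: mult_ac)
  then have "2 * ((c * y) * c) = y" by (simp only: c(2) mult_1_left)
  ultimately have "y \<le> sin x" by linarith
  then show ?thesis by (simp add: y_def)
qed

text \<open>A geometric sum of ratio \<open>w = echar p t\<close> has norm at most 2 divided by the
  norm of \<open>w - 1\<close>. The latter is bounded below because \<open>t\<close> has distance at
  least \<open>L\<close> from every multiple of \<open>p\<close>.\<close>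

lemma norm_geometric_echar_le:
  assumes "p > 0" "L > 0" "int L \<le> t mod int p" "t mod int p \<le> int p - int L"
  shows "norm (\<Sum>k<K. echar p (int k * t)) \<le> real p / real L"
proof -
  \<comment> \<open>Half the angle of \<open>echar p t\<close>, so that the chord from 1 to
    \<open>echar p t\<close> has length \<open>2 * sin x\<close>.\<close>
  define x where "x = pi * real_of_int (t mod int p) / real p"
  have neq: "echar p t \<noteq> 1" using assms echar_eq_1_iff by (auto simp: mod_eq_0_iff_dvd)
  have sinx: "real L / real p \<le> sin x"
  proof -
    \<comment> \<open>As \<open>pi\<close> is at least 2, the factor 1/2 lost in
      \<open>half_le_sin\<close> is regained here.\<close>
    have lp: "real L / real p \<le> y / 2" if "pi * real L / real p \<le> y" for y
    proof -
      have "2 * (real L / real p) \<le> pi * (real L / real p)"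
        using pi_ge_two by (intro mult_right_mono) auto
      moreover have "pi * (real L / real p) = pi * real L / real p" by simp
      ultimately show ?thesis using that by linarith
    qed
    have x1: "pi * real L / real p \<le> x"
      unfolding x_def using assms by (intro divide_right_mono mult_left_mono) auto
    have "real_of_int (t mod int p) \<le> real p - real L" using assms(4) by linarith
    then have "pi * real_of_int (t mod int p) / real p \<le> pi * (real p - real L) / real p"
      by (intro divide_right_mono mult_left_mono) auto
    then have x2: "pi * real L / real p \<le> pi - x"
      using assms(1) unfolding x_def by (simp add: field_simps)
    have p0: "0 \<le> pi * real L / real p" by simp
    show ?thesis
    proof (cases "x \<le> pi / 2")
      case True
      then show ?thesis using half_le_sin[of x] lp[OF x1] x1 p0 by linarith
    next
      case False
      moreover have "0 \<le> pi - x" using x2 p0 by linarith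
      ultimately have "(pi - x) / 2 \<le> sin (pi - x)" by (intro half_le_sin) auto
      then show ?thesis using lp[OF x2] sin_pi_minus[of x] by linarith
    qed
  qed
  have "norm (echar p t - 1) = 2 * \<bar>sin x\<bar>"
  proof -
    have "echar p t = cis (2 * x)"
      using echar_mod[OF assms(1), of t] by (simp add: echar_def x_def field_simps)
    also have "cis (2 * x) - 1 = cis x * (2 * \<i> * sin x)"
      by (simp add: complex_eq_iff sin_double cos_double_sin power2_eq_square)
    finally show ?thesis by (simp add: norm_mult)
  qed
  then have low: "2 * (real L / real p) \<le> norm (echar p t - 1)" using sinx by simp
  have pos: "0 < real L / real p" using assms by simp
  have "norm (\<Sum>k<K. echar p (int k * t)) = norm (echar p t ^ K - 1) / norm (echar p t - 1)"
    using neq by (simp add: echar_of_nat_mult geometric_sum norm_divide)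
  also have "\<dots> \<le> 2 / norm (echar p t - 1)"
  proof (intro divide_right_mono)
    have "norm (echar p t ^ K - 1) \<le> norm (echar p t ^ K) + norm (1::complex)" by (rule norm_triangle_ineq4)
    then show "norm (echar p t ^ K - 1) \<le> 2" by (simp add: norm_power)
  qed simp
  also have "\<dots> \<le> 2 / (2 * (real L / real p))"
    by (rule frac_le) (use low pos in linarith)+
  finally show ?thesis by simp
qed

text \<open>
  Summing over the multiples \<open>k * t i\<close> with \<open>k < K\<close>, instead of using only \<open>k = 1\<close>, is what makes
  a gain of order \<open>L / p\<close> rather than \<open>(L / p)\<^sup>2\<close> per step possible below.
\<close>

lemma spread_character_sum:
  fixes t :: "'i \<Rightarrow> int"
  assumes "p > 0" "finite A" "L > 0" "8 * p \<le> K * L" "16 * L * H \<le> card A"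
    and spread: "\<And>c. card {i\<in>A. int p dvd t i - c} \<le> H"
  shows "norm (\<Sum>i\<in>A. \<Sum>k<K. echar p (int k * t i)) \<le> real (card A * K) / 4"
proof -
  \<comment> \<open>The bad indices have \<open>t i\<close> in one of fewer than
    \<open>2 * L\<close> residue classes near 0, so they make up at most 1/8 of \<open>A\<close> and
    contribute at most 1/8 of the trivial bound. The other geometric sums are at most
    \<open>p / L\<close>, hence at most \<open>K / 8\<close>, and contribute another 1/8.\<close>
  define B where "B = {i\<in>A. t i mod int p < int L \<or> t i mod int p > int p - int L}"
  have B: "B \<subseteq> A" "finite B" using assms by (auto simp: B_def)
  have "B \<subseteq> (\<Union>c\<in>{- int L<..<int L}. {i\<in>A. int p dvd t i - c})"
  proof
    fix i assume i: "i \<in> B"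
    have bounds: "0 \<le> t i mod int p" "t i mod int p < int p" using assms by auto
    have dvd: "int p dvd t i - t i mod int p" by (rule dvd_minus_mod)
    show "i \<in> (\<Union>c\<in>{- int L<..<int L}. {i\<in>A. int p dvd t i - c})"
    proof (cases "t i mod int p < int L")
      case True
      moreover have "- int L < t i mod int p" using bounds assms(3) by linarith
      ultimately show ?thesis using i dvd by (intro UN_I[of "t i mod int p"]) (auto simp: B_def)
    next
      case False
      have "int p dvd t i - t i mod int p + int p" using dvd by simp
      then have "int p dvd t i - (t i mod int p - int p)" by (simp add: algebra_simps)
      then show ?thesis using i bounds False by (intro UN_I[of "t i mod int p - int p"]) (auto simp: B_def)
    qed
  qed
  then have "card B \<le> card (\<Union>c\<in>{- int L<..<int L}. {i\<in>A. int p dvd t i - c})"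
    by (intro card_mono) (use assms in auto)
  also have "\<dots> \<le> (\<Sum>c\<in>{- int L<..<int L}. card {i\<in>A. int p dvd t i - c})"
    by (intro card_UN_le) auto
  also have "\<dots> \<le> (\<Sum>c\<in>{- int L<..<int L}. H)" by (intro sum_mono spread)
  also have "\<dots> = nat (2 * int L - 1) * H" by simp
  also have "\<dots> \<le> 2 * L * H" by (intro mult_right_mono) (linarith, simp)
  finally have "8 * card B \<le> card A" using assms(5) by linarith
  then have cB: "real (card B) \<le> real (card A) / 8" by linarith
  have "norm (\<Sum>i\<in>A. \<Sum>k<K. echar p (int k * t i)) \<le> (\<Sum>i\<in>A. norm (\<Sum>k<K. echar p (int k * t i)))"
    by (rule norm_sum)
  also have "\<dots> = (\<Sum>i\<in>A - B. norm (\<Sum>k<K. echar p (int k * t i))) +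
      (\<Sum>i\<in>B. norm (\<Sum>k<K. echar p (int k * t i)))"
    using B assms by (intro sum.subset_diff) auto
  also have "\<dots> \<le> (\<Sum>i\<in>A - B. real K / 8) + (\<Sum>i\<in>B. real K)"
  proof (intro add_mono sum_mono)
    fix i assume "i \<in> A - B"
    then have "norm (\<Sum>k<K. echar p (int k * t i)) \<le> real p / real L"
      by (intro norm_geometric_echar_le) (use assms in \<open>auto simp: B_def\<close>)
    also have "\<dots> \<le> real K / 8"
    proof -
      have "real (8 * p) \<le> real (K * L)" using assms(4) by (rule of_nat_mono)
      then show ?thesis using assms(3) by (simp add: field_simps)
    qed
    finally show "norm (\<Sum>k<K. echar p (int k * t i)) \<le> real K / 8" .
  next
    fix i
    have "norm (\<Sum>k<K. echar p (int k * t i)) \<le> (\<Sum>k<K. norm (echar p (int k * t i)))"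
      by (rule norm_sum)
    then show "norm (\<Sum>k<K. echar p (int k * t i)) \<le> real K" by simp
  qed
  also have "\<dots> = real (card (A - B)) * (real K / 8) + real (card B) * real K" by simp
  also have "\<dots> \<le> real (card A) * (real K / 8) + real (card A) / 8 * real K"
    using B assms by (intro add_mono mult_right_mono cB) (auto intro!: card_mono)
  finally show ?thesis by (simp add: mult.commute)
qed

section \<open>Expansion under a suitable translation\<close>

text \<open>An element of the \<open>k\<close>-fold translate that lies outside \<open>Y\<close>
  must have left \<open>Y\<close> in one of \<open>k\<close> successive shifts by
  \<open>x\<close>.\<close>

lemma card_translate_diff_multiple:
  assumes "p > 0" "finite Y" "Y \<subseteq> vecs p J"
  shows "card (translate p J (\<lambda>j. int k * x j) ` Y - Y) \<le> k * card (translate p J x ` Y - Y)"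
proof (induction k)
  case 0
  have "translate p J (\<lambda>j. 0) ` Y \<subseteq> Y" using assms by (auto simp: translate_0 subset_iff)
  then have "translate p J (\<lambda>j. int 0 * x j) ` Y - Y = {}" by auto
  then show ?case by (simp only: card.empty)
next
  case (Suc k)
  let ?f = "translate p J x" and ?g = "translate p J (\<lambda>j. int k * x j)"
  have fg: "translate p J (\<lambda>j. int (Suc k) * x j) y = ?f (?g y)" for y
    by (simp add: translate_translate algebra_simps)
  have "translate p J (\<lambda>j. int (Suc k) * x j) ` Y - Y \<subseteq> ?f ` (?g ` Y - Y) \<union> (?f ` Y - Y)"
    unfolding fg by blast
  then have "card (translate p J (\<lambda>j. int (Suc k) * x j) ` Y - Y)
      \<le> card (?f ` (?g ` Y - Y) \<union> (?f ` Y - Y))"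
    by (intro card_mono) (use assms in auto)
  also have "\<dots> \<le> card (?f ` (?g ` Y - Y)) + card (?f ` Y - Y)" by (rule card_Un_le)
  also have "card (?f ` (?g ` Y - Y)) \<le> card (?g ` Y - Y)"
    by (intro card_image_le) (use assms in auto)
  finally show ?case using Suc.IH by simp
qed

lemma dotp_scale: "dotp J u (\<lambda>j. c * x j) = c * dotp J u x"
  by (simp add: dotp_def sum_distrib_left algebra_simps)

text \<open>Average the overlap of \<open>Y\<close> with its translates by \<open>k * d i\<close>
  over \<open>i\<close> and \<open>k\<close>. The trivial character contributes at most
  \<open>card Y / 2\<close> since \<open>Y\<close> is at most half of the group; the others
  contribute at most \<open>card Y / 4\<close> by Parseval and the spread. So some overlap is at
  most \<open>3 / 4 * card Y\<close>, some multiple of \<open>d i\<close> moves a quarter of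
  \<open>Y\<close> outside, and \<open>d i\<close> itself moves at least a fraction
  \<open>1 / (4 * K)\<close>.\<close>

lemma expansion:
  fixes d :: "'i \<Rightarrow> 'j \<Rightarrow> int"
  assumes "p > 0" "finite J" "finite A" "A \<noteq> {}" "L > 0" "8 * p \<le> K * L" "16 * L * H \<le> card A"
    and spread: "\<And>u c. u \<in> vecs p J \<Longrightarrow> \<exists>j\<in>J. u j \<noteq> 0 \<Longrightarrow>
                  card {i\<in>A. int p dvd dotp J u (d i) - c} \<le> H"
    and Y: "Y \<subseteq> vecs p J" "2 * card Y \<le> p ^ card J"
  shows "\<exists>i\<in>A. card Y \<le> 4 * K * card (translate p J (d i) ` Y - Y)"
proof -
  let ?V = "vecs p J" and ?F = "\<lambda>u. (norm (fourier p J Y u))\<^sup>2"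
  define g where "g i k = card (Y \<inter> translate p J (\<lambda>j. int k * d i j) ` Y)" for i k
  define E where "E u = (\<Sum>i\<in>A. \<Sum>k<K. echar p (int k * dotp J u (d i)))" for u
  \<comment> \<open>The trivial character, the only one to which the spread hypothesis does not
    apply.\<close>
  define z where "z = (\<lambda>j\<in>J. 0::int)"
  have fin: "finite Y" using Y(1) assms finite_subset finite_vecs by blast
  have z: "z \<in> ?V" using assms by (auto simp: z_def vecs_def)
  have nz: "\<exists>j\<in>J. u j \<noteq> 0" if "u \<in> ?V - {z}" for u
    using that by (auto simp: z_def vecs_def PiE_iff extensional_def fun_eq_iff split: if_splits)
  have dz: "dotp J z x = 0" for x by (simp add: dotp_def z_def)
  have Kpos: "K > 0" using assms by (intro Nat.gr0I) auto
  have Ez: "E z = of_nat (card A * K)" by (simp add: E_def dz)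
  have Fz: "?F z = real (card Y) * real (card Y)"
    by (simp add: fourier_def dz power2_eq_square)
  have "complex_of_real (real (p ^ card J) * (\<Sum>i\<in>A. \<Sum>k<K. real (g i k))) =
      (\<Sum>i\<in>A. \<Sum>k<K. of_nat (p ^ card J * g i k))"
    by (simp add: sum_distrib_left)
  also have "\<dots> = (\<Sum>i\<in>A. \<Sum>k<K. \<Sum>u\<in>?V. of_real (?F u) * echar p (int k * dotp J u (d i)))"
    unfolding g_def using assms Y by (intro sum.cong refl) (simp only: autocorrelation dotp_scale)
  also have "\<dots> = (\<Sum>i\<in>A. \<Sum>u\<in>?V. \<Sum>k<K. of_real (?F u) * echar p (int k * dotp J u (d i)))"
    by (intro sum.cong refl sum.swap)
  also have "\<dots> = (\<Sum>u\<in>?V. \<Sum>i\<in>A. \<Sum>k<K. of_real (?F u) * echar p (int k * dotp J u (d i)))"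
    by (rule sum.swap)
  also have "\<dots> = (\<Sum>u\<in>?V. of_real (?F u) * E u)"
    by (simp add: E_def sum_distrib_left)
  finally have key: "complex_of_real (real (p ^ card J) * (\<Sum>i\<in>A. \<Sum>k<K. real (g i k))) =
      (\<Sum>u\<in>?V. of_real (?F u) * E u)" .
  have "real (p ^ card J) * (\<Sum>i\<in>A. \<Sum>k<K. real (g i k)) \<le>
      norm (complex_of_real (real (p ^ card J) * (\<Sum>i\<in>A. \<Sum>k<K. real (g i k))))"
    by (simp only: norm_of_real abs_ge_self)
  also have "\<dots> \<le> (\<Sum>u\<in>?V. norm (of_real (?F u) * E u))"
    unfolding key by (rule norm_sum)
  also have "\<dots> = ?F z * norm (E z) + (\<Sum>u\<in>?V - {z}. ?F u * norm (E u))"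
    using z assms by (subst sum.remove[of _ z]) (auto simp: norm_mult norm_power)
  also have "\<dots> \<le> ?F z * norm (E z) + (\<Sum>u\<in>?V - {z}. ?F u * (real (card A * K) / 4))"
  proof (intro add_left_mono sum_mono mult_left_mono)
    fix u assume u: "u \<in> ?V - {z}"
    show "norm (E u) \<le> real (card A * K) / 4"
      unfolding E_def
      by (rule spread_character_sum[where L = L and H = H])
         (use assms nz[OF u] u in \<open>auto intro!: spread\<close>)
  qed simp
  \<comment> \<open>The term for \<open>z\<close> is put back into the sum so that Parseval applies
    to all of \<open>?V\<close>.\<close>
  also have "\<dots> \<le> ?F z * norm (E z) + (\<Sum>u\<in>?V. ?F u * (real (card A * K) / 4))"
    using assms by (intro add_left_mono sum_mono2) auto
  also have "(\<Sum>u\<in>?V. ?F u * (real (card A * K) / 4)) =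
      (\<Sum>u\<in>?V. ?F u) * (real (card A * K) / 4)"
    by (simp only: sum_distrib_right)
  also have "\<dots> = real (p ^ card J * card Y) * (real (card A * K) / 4)"
    by (simp only: parseval[OF assms(1,2) Y(1)])
  also have "?F z * norm (E z) = real (card Y) * real (card Y) * real (card A * K)"
    by (simp add: Ez Fz norm_mult)
  also have "\<dots> \<le> real (p ^ card J) / 2 * real (card Y) * real (card A * K)"
  proof (intro mult_right_mono)
    have "real (2 * card Y) \<le> real (p ^ card J)" using Y(2) by (rule of_nat_mono)
    then show "real (card Y) \<le> real (p ^ card J) / 2" by simp
  qed auto
  finally have "real (p ^ card J) * (\<Sum>i\<in>A. \<Sum>k<K. real (g i k)) \<le>
     real (p ^ card J) * (3 / 4 * real (card Y) * real (card A * K))"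
    by (simp add: algebra_simps)
  then have total: "(\<Sum>i\<in>A. \<Sum>k<K. real (g i k)) \<le> 3 / 4 * real (card Y) * real (card A * K)"
    using assms(1) by (simp only: mult_le_cancel_left_pos of_nat_0_less_iff zero_less_power)
  have "\<exists>i\<in>A. \<exists>k<K. real (g i k) \<le> 3 / 4 * real (card Y)"
  proof (rule ccontr)
    assume "\<not> ?thesis"
    then have "(\<Sum>i\<in>A. \<Sum>k<K. 3 / 4 * real (card Y)) < (\<Sum>i\<in>A. \<Sum>k<K. real (g i k))"
      using assms(3,4) Kpos by (intro sum_strict_mono) (auto simp: lessThan_empty_iff not_le)
    then show False using total by (simp add: algebra_simps)
  qed
  then obtain i k where ik: "i \<in> A" "k < K" "real (g i k) \<le> 3 / 4 * real (card Y)" by blast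
  let ?T = "translate p J (\<lambda>j. int k * d i j) ` Y"
  have "card ?T = card (?T \<inter> Y) + card (?T - Y)"
    using fin by (intro card_Int_Diff) auto
  then have "card Y = g i k + card (?T - Y)"
    using card_translate[OF Y(1)] by (simp add: g_def Int_commute)
  then have "card Y \<le> 4 * card (?T - Y)" using ik(3) by linarith
  also have "\<dots> \<le> 4 * (k * card (translate p J (d i) ` Y - Y))"
    by (intro mult_left_mono card_translate_diff_multiple) (use assms fin Y in auto)
  also have "\<dots> \<le> 4 * (K * card (translate p J (d i) ` Y - Y))"
    using ik(2) by (intro mult_left_mono mult_right_mono) auto
  finally show ?thesis using ik(1) by (auto simp: mult.assoc)
qed

section \<open>Zero-sum subsequences of prime length\<close>

text \<open>The number of summands is fixed so that the zero-sum subsequence found in the end has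
  exactly \<open>p\<close> terms. Inside an affine hyperplane its constant is then added
  \<open>p\<close> times and disappears modulo \<open>p\<close>.\<close>

definition subsums :: "nat \<Rightarrow> 'j set \<Rightarrow> ('i \<Rightarrow> 'j \<Rightarrow> int) \<Rightarrow> nat \<Rightarrow> 'i set \<Rightarrow> ('j \<Rightarrow> int) set" where
  "subsums p J a m B = (\<lambda>T. \<lambda>j\<in>J. (\<Sum>i\<in>T. a i j) mod int p) ` {T. T \<subseteq> B \<and> card T = m}"

lemma subsums_subset_vecs: "p > 0 \<Longrightarrow> subsums p J a m B \<subseteq> vecs p J"
  by (auto simp: subsums_def vecs_def)

lemma subsums_insert:
  assumes "finite B" "i \<in> B'" "i \<notin> B" "B \<subseteq> B'"
  shows "translate p J (a i) ` subsums p J a m B \<subseteq> subsums p J a (Suc m) B'"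
proof
  fix y assume "y \<in> translate p J (a i) ` subsums p J a m B"
  then obtain T where T: "T \<subseteq> B" "card T = m"
    and y: "y = translate p J (a i) (\<lambda>j\<in>J. (\<Sum>i\<in>T. a i j) mod int p)"
    by (auto simp: subsums_def)
  have "finite T" "i \<notin> T" using T assms finite_subset by auto
  then have "y = (\<lambda>j\<in>J. (\<Sum>i\<in>insert i T. a i j) mod int p)" "card (insert i T) = Suc m"
    using T by (auto simp: y translate_def restrict_def fun_eq_iff mod_simps add.commute)
  moreover have "insert i T \<subseteq> B'" using T assms by auto
  ultimately show "y \<in> subsums p J a (Suc m) B'" unfolding subsums_def by blast
qed

text \<open>
  Each step commits two further indices \<open>i0\<close> and \<open>i\<close>, exactly one of which is summed, so that
  the set of sums \<open>Y\<close> becomes a translate of \<open>Y \<union> (Y + a i - a i0)\<close>.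
\<close>

lemma subsums_growth:
  fixes a :: "'i \<Rightarrow> 'j \<Rightarrow> int"
  assumes "p > 0" "finite J" "finite I" "H > 0" "L > 0" "8 * p \<le> K * L" "16 * L * H + 2 * m \<le> card I"
    and spread: "\<And>u c. u \<in> vecs p J \<Longrightarrow> \<exists>j\<in>J. u j \<noteq> 0 \<Longrightarrow>
                  card {i\<in>I. int p dvd dotp J u (a i) - c} \<le> H"
  shows "\<exists>B\<subseteq>I. card B = 2 * m \<and> (2 * card (subsums p J a m B) > p ^ card J \<or>
           real (card (subsums p J a m B)) \<ge> (1 + 1 / (4 * real K)) ^ m)"
  using assms(7)
proof (induction m)
  case 0
  have "subsums p J a 0 {} = {\<lambda>j\<in>J. 0}" by (auto simp: subsums_def)
  then show ?case by (intro exI[of _ "{}"]) auto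
next
  case (Suc m)
  then obtain B where B: "B \<subseteq> I" "card B = 2 * m"
    and grown: "2 * card (subsums p J a m B) > p ^ card J \<or>
           real (card (subsums p J a m B)) \<ge> (1 + 1 / (4 * real K)) ^ m"
    by auto
  let ?Y = "subsums p J a m B"
  have Y: "?Y \<subseteq> vecs p J" by (rule subsums_subset_vecs[OF assms(1)])
  have finY: "finite ?Y" using Y assms finite_subset finite_vecs by blast
  have finB: "finite B" using B assms finite_subset by blast
  have Kpos: "K > 0" using assms by (intro Nat.gr0I) auto
  have cA: "card (I - B) = card I - 2 * m" using B finB by (simp add: card_Diff_subset)
  define M where "M = 16 * L * H"
  \<comment> \<open>Two indices are committed in this step; without \<open>i0\<close>, the expansion
    still has the \<open>16 * L * H\<close> indices it needs.\<close>
  have big: "card (I - B) \<ge> M + 2" unfolding cA using Suc.prems by (simp add: M_def)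
  then have "I - B \<noteq> {}" by (intro notI) simp
  then obtain i0 where i0: "i0 \<in> I - B" by blast
  define A where "A = I - B - {i0}"
  have finA: "finite A" using assms by (simp add: A_def)
  have "card A = card (I - B) - 1" using i0 assms by (simp add: A_def)
  then have "M < card A" using big by linarith
  then have cardA: "16 * L * H \<le> card A" and "card A > 0" by (auto simp: M_def)
  then have Ane: "A \<noteq> {}" by auto
  define d where "d i = (\<lambda>j. a i j - a i0 j)" for i
  \<comment> \<open>Subtracting \<open>a i0\<close> only replaces each affine hyperplane by a
    parallel one, so the spread bound survives.\<close>
  have spread_d: "card {i\<in>A. int p dvd dotp J u (d i) - c} \<le> H"
    if u: "u \<in> vecs p J" "\<exists>j\<in>J. u j \<noteq> 0" for u c
  proof -
    have "dotp J u (d i) - c = dotp J u (a i) - (dotp J u (a i0) + c)" for i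
      by (simp add: d_def dotp_def right_diff_distrib sum_subtractf)
    then have "{i\<in>A. int p dvd dotp J u (d i) - c} = {i\<in>A. int p dvd dotp J u (a i) - (dotp J u (a i0) + c)}"
      by (simp only:)
    also have "\<dots> \<subseteq> {i\<in>I. int p dvd dotp J u (a i) - (dotp J u (a i0) + c)}"
      by (rule Collect_mono) (simp add: A_def)
    finally have "{i\<in>A. int p dvd dotp J u (d i) - c} \<subseteq> \<dots>" .
    then have "card {i\<in>A. int p dvd dotp J u (d i) - c} \<le> card {i\<in>I. int p dvd dotp J u (a i) - (dotp J u (a i0) + c)}"
      using assms by (intro card_mono) auto
    also have "\<dots> \<le> H" by (rule spread[OF u])
    finally show ?thesis .
  qed
  have step: "card ?Y + card (translate p J (d i) ` ?Y - ?Y) \<le> card (subsums p J a (Suc m) (B \<union> {i0, i}))"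
    if "i \<in> A" for i
  proof -
    have "translate p J (a i0) ` ?Y \<subseteq> subsums p J a (Suc m) (B \<union> {i0, i})"
      using i0 by (intro subsums_insert finB) auto
    moreover have "translate p J (a i) ` ?Y \<subseteq> subsums p J a (Suc m) (B \<union> {i0, i})"
      using that by (intro subsums_insert finB) (auto simp: A_def)
    moreover have "translate p J (a i) y = translate p J (a i0) (translate p J (d i) y)" for y
      unfolding translate_translate by (rule translate_cong) (simp add: d_def)
    ultimately have "translate p J (a i0) ` (?Y \<union> translate p J (d i) ` ?Y) \<subseteq> subsums p J a (Suc m) (B \<union> {i0, i})"
      by auto
    moreover have "finite (subsums p J a (Suc m) (B \<union> {i0, i}))"
      using subsums_subset_vecs[OF assms(1)] finite_vecs[OF assms(2)] by (rule finite_subset)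
    ultimately have "card (translate p J (a i0) ` (?Y \<union> translate p J (d i) ` ?Y)) \<le> card (subsums p J a (Suc m) (B \<union> {i0, i}))"
      by (intro card_mono)
    also have "card (translate p J (a i0) ` (?Y \<union> translate p J (d i) ` ?Y)) = card (?Y \<union> translate p J (d i) ` ?Y)"
      using Y assms(1) by (intro card_translate) (auto intro: translate_in_vecs)
    also have "\<dots> = card ?Y + card (translate p J (d i) ` ?Y - ?Y)"
      using finY by (subst Un_Diff_cancel [symmetric], intro card_Un_disjoint) auto
    finally show ?thesis .
  qed
  have sub: "B \<union> {i0, i} \<subseteq> I" and crd: "card (B \<union> {i0, i}) = 2 * Suc m" if "i \<in> A" for i
    using that i0 B finB by (auto simp: A_def)
  show ?case
  proof (cases "2 * card ?Y > p ^ card J")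
    \<comment> \<open>Any further step keeps more than half of the group, since the new set of sums
      contains a translate of the old one.\<close>
    case True
    obtain i where i: "i \<in> A" using Ane by blast
    show ?thesis
      using step[OF i] True sub[OF i] crd[OF i] by (intro exI[of _ "B \<union> {i0, i}"]) auto
  next
    case False
    then obtain i where i: "i \<in> A" and *: "card ?Y \<le> 4 * K * card (translate p J (d i) ` ?Y - ?Y)"
      using expansion[OF assms(1,2) finA Ane assms(5,6) cardA spread_d Y] by auto
    have "real (card ?Y) \<le> real (4 * K * card (translate p J (d i) ` ?Y - ?Y))"
      using * by (rule of_nat_mono)
    then have "real (card ?Y) / (4 * real K) \<le> real (card (translate p J (d i) ` ?Y - ?Y))"
      using Kpos by (simp add: field_simps)
    then have st: "(1 + 1 / (4 * real K)) * real (card ?Y) \<le> real (card ?Y + card (translate p J (d i) ` ?Y - ?Y))"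
      by (simp add: algebra_simps)
    have "(1 + 1 / (4 * real K)) ^ m \<le> real (card ?Y)" using grown False by blast
    then have "(1 + 1 / (4 * real K)) ^ Suc m \<le> (1 + 1 / (4 * real K)) * real (card ?Y)"
      unfolding power_Suc by (rule mult_left_mono) simp
    also note st
    also have "real (card ?Y + card (translate p J (d i) ` ?Y - ?Y)) \<le> real (card (subsums p J a (Suc m) (B \<union> {i0, i})))"
      using step[OF i] by (rule of_nat_mono)
    finally show ?thesis
      using sub[OF i] crd[OF i] by blast
  qed
qed

text \<open>By Bernoulli's inequality, \<open>4 * K\<close> growth steps at least double the size.
  So \<open>m\<close> steps reach the size of the whole group unless half of it was exceeded
  before.\<close>

lemma subsums_more_than_half:
  fixes a :: "'i \<Rightarrow> 'j \<Rightarrow> int"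
  assumes "p > 0" "finite J" "finite I" "H > 0" "L > 0" "8 * p \<le> K * L" "16 * L * H + 2 * m \<le> card I"
    and "p \<le> 2 ^ l" "4 * K * (card J * l) \<le> m"
    and spread: "\<And>u c. u \<in> vecs p J \<Longrightarrow> \<exists>j\<in>J. u j \<noteq> 0 \<Longrightarrow>
                  card {i\<in>I. int p dvd dotp J u (a i) - c} \<le> H"
  shows "\<exists>B\<subseteq>I. card B = 2 * m \<and> 2 * card (subsums p J a m B) > p ^ card J"
proof -
  have Kpos: "K > 0" using assms by (intro Nat.gr0I) auto
  have "real p ^ card J \<le> (1 + 1 / (4 * real K)) ^ m"
  proof -
    have "real p ^ card J \<le> (2 ^ l) ^ card J"
      using assms(8) by (intro power_mono) (simp_all add: of_nat_le_iff [symmetric] del: of_nat_le_iff)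
    also have "\<dots> = 2 ^ (card J * l)" by (simp add: power_mult [symmetric] mult.commute)
    also have "\<dots> \<le> ((1 + 1 / (4 * real K)) ^ (4 * K)) ^ (card J * l)"
    proof (intro power_mono)
      have "1 + real (4 * K) * (1 / (4 * real K)) \<le> (1 + 1 / (4 * real K)) ^ (4 * K)"
        by (rule Bernoulli_inequality) (simp add: order_trans[of _ 0])
      then show "2 \<le> (1 + 1 / (4 * real K)) ^ (4 * K)" using Kpos by simp
    qed simp
    also have "\<dots> = (1 + 1 / (4 * real K)) ^ (4 * K * (card J * l))" by (rule power_mult [symmetric])
    also have "\<dots> \<le> (1 + 1 / (4 * real K)) ^ m"
      using assms(9) by (intro power_increasing) auto
    finally show ?thesis .
  qed
  moreover obtain B where "B \<subseteq> I" "card B = 2 * m" "2 * card (subsums p J a m B) > p ^ card J \<or>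
           real (card (subsums p J a m B)) \<ge> (1 + 1 / (4 * real K)) ^ m"
    using subsums_growth[OF assms(1-7) spread] by blast
  moreover have "2 * c > p ^ card J" if "real p ^ card J \<le> real c" for c
  proof -
    have "real (p ^ card J) \<le> real c" using that by simp
    then have "p ^ card J \<le> c" by (simp only: of_nat_le_iff)
    moreover have "p ^ card J > 0" using assms(1) by simp
    ultimately show ?thesis by linarith
  qed
  ultimately show ?thesis by (meson order_trans)
qed

text \<open>Two disjoint index sets each have sums of \<open>p div 2\<close> terms filling more than
  half of the group. Two such sets of values cannot avoid each other after a reflection, so any
  prescribed element is a sum of one value from each.\<close>

lemma spread_zero_sum:
  fixes a :: "'i \<Rightarrow> 'j \<Rightarrow> int"
  assumes "p > 0" "finite J" "finite I" "H > 0" "L > 0" "8 * p \<le> K * L" "16 * L * H + 2 * p \<le> card I"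
    and "p \<le> 2 ^ l" "4 * K * (card J * l) \<le> p div 2"
    and spread: "\<And>u c. u \<in> vecs p J \<Longrightarrow> \<exists>j\<in>J. u j \<noteq> 0 \<Longrightarrow>
                  card {i\<in>I. int p dvd dotp J u (a i) - c} \<le> H"
  shows "\<exists>T\<subseteq>I. card T = p \<and> (\<forall>j\<in>J. int p dvd (\<Sum>i\<in>T. a i j))"
proof -
  let ?m = "p div 2"
  have m: "2 * ?m \<le> p" by simp
  have big: "2 * p \<le> card I" using assms(7) by (rule add_leD2)
  have mI: "16 * L * H + 2 * ?m \<le> card I" using assms(7) by simp
  obtain B where B: "B \<subseteq> I" "card B = 2 * ?m" "2 * card (subsums p J a ?m B) > p ^ card J"
    using subsums_more_than_half[OF assms(1-6) mI assms(8,9) spread] by blast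
  have finB: "finite B" using B assms finite_subset by blast
  have cB: "card (I - B) = card I - 2 * ?m" using B finB by (simp add: card_Diff_subset)
  have spread': "card {i\<in>I - B. int p dvd dotp J u (a i) - c} \<le> H"
    if "u \<in> vecs p J" "\<exists>j\<in>J. u j \<noteq> 0" for u c
    by (rule order_trans[OF card_mono spread[OF that, of c]]) (use assms in auto)
  have mI': "16 * L * H + 2 * ?m \<le> card (I - B)"
    using assms(7) m unfolding cB by (simp add: algebra_simps)
  obtain B' where B': "B' \<subseteq> I - B" "card B' = 2 * ?m" "2 * card (subsums p J a ?m B') > p ^ card J"
    using subsums_more_than_half[OF assms(1,2) finite_Diff[OF assms(3)] assms(4-6) mI' assms(8,9) spread']
    by blast
  have finB': "finite B'" using B'(1) finite_Diff[OF assms(3)] by (rule finite_subset)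
  have "card (I - B - B') = card I - 2 * ?m - 2 * ?m"
    using B' finB' cB by (simp add: card_Diff_subset)
  then have "p - 2 * ?m \<le> card (I - B - B')" using m big
    by linarith
  \<comment> \<open>\<open>C\<close> pads the length to exactly \<open>p\<close>: it has one element
    if \<open>p\<close> is odd and none if \<open>p\<close> is even.\<close>
  then obtain C where C: "C \<subseteq> I - B - B'" "card C = p - 2 * ?m" and finC: "finite C"
    by (rule obtain_subset_with_card_n)
  let ?Y = "subsums p J a ?m B" and ?Z = "subsums p J a ?m B'"
  \<comment> \<open>The value that a sum over indices from \<open>B\<close> must take in order to
    cancel \<open>z\<close> together with the sum over \<open>C\<close>.\<close>
  define r where "r z = (\<lambda>j\<in>J. (- (\<Sum>i\<in>C. a i j) - z j) mod int p)" for z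
  have V: "?Y \<subseteq> vecs p J" "?Z \<subseteq> vecs p J" by (auto intro!: subsums_subset_vecs assms)
  have rV: "r ` ?Z \<subseteq> vecs p J" using assms(1) by (auto simp: r_def vecs_def)
  have "inj_on r ?Z"
  proof (rule inj_onI)
    fix y z assume yz: "y \<in> ?Z" "z \<in> ?Z" "r y = r z"
    show "y = z"
    proof (rule vecs_eqI[of _ p J])
      show "y \<in> vecs p J" "z \<in> vecs p J" using yz V by auto
      fix j assume "j \<in> J"
      then have "(- (\<Sum>i\<in>C. a i j) - z j) mod int p = (- (\<Sum>i\<in>C. a i j) - y j) mod int p"
        using fun_cong[OF yz(3), of j] by (simp add: r_def)
      then show "int p dvd y j - z j" by (simp add: mod_eq_dvd_iff)
    qed
  qed
  then have "card (r ` ?Z) = card ?Z" by (rule card_image)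
  have "?Y \<inter> r ` ?Z \<noteq> {}"
  proof
    assume "?Y \<inter> r ` ?Z = {}"
    moreover have "finite ?Y" "finite (r ` ?Z)"
      using finite_subset[OF V(1) finite_vecs[OF assms(2)]] finite_subset[OF rV finite_vecs[OF assms(2)]]
      by auto
    ultimately have "card (?Y \<union> r ` ?Z) = card ?Y + card ?Z"
      using \<open>card (r ` ?Z) = card ?Z\<close> by (simp add: card_Un_disjoint)
    moreover have "card (?Y \<union> r ` ?Z) \<le> p ^ card J"
      unfolding card_vecs[OF assms(2), symmetric] by (intro card_mono) (use V rV assms in auto)
    ultimately show False using B(3) B'(3) by linarith
  qed
  then obtain z where z: "z \<in> ?Z" "r z \<in> ?Y" by auto
  then obtain T T' where T: "T \<subseteq> B" "card T = ?m" "r z = (\<lambda>j\<in>J. (\<Sum>i\<in>T. a i j) mod int p)"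
    and T': "T' \<subseteq> B'" "card T' = ?m" "z = (\<lambda>j\<in>J. (\<Sum>i\<in>T'. a i j) mod int p)"
    by (auto simp: subsums_def)
  have fin: "finite T" "finite T'" using T T' finB finB' finite_subset by auto
  have disj: "T \<inter> T' = {}" "(T \<union> T') \<inter> C = {}" using T T' B B' C by auto
  have "card (T \<union> T' \<union> C) = p"
  proof -
    have "card (T \<union> T' \<union> C) = ?m + ?m + (p - 2 * ?m)"
      using fin finC disj T(2) T'(2) C(2) by (simp add: card_Un_disjoint)
    then show ?thesis by simp
  qed
  moreover have "T \<union> T' \<union> C \<subseteq> I" using T T' B B' C by auto
  moreover have "int p dvd (\<Sum>i\<in>T \<union> T' \<union> C. a i j)" if j: "j \<in> J" for j
  proof -
    have "(\<Sum>i\<in>T. a i j) mod int p = (- (\<Sum>i\<in>C. a i j) - (\<Sum>i\<in>T'. a i j)) mod int p"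
      using fun_cong[OF T(3), of j] j by (simp add: r_def T'(3) mod_simps)
    then have "int p dvd (\<Sum>i\<in>T. a i j) - (- (\<Sum>i\<in>C. a i j) - (\<Sum>i\<in>T'. a i j))"
      by (simp only: mod_eq_dvd_iff)
    moreover have "(\<Sum>i\<in>T \<union> T' \<union> C. a i j) = (\<Sum>i\<in>T. a i j) + (\<Sum>i\<in>T'. a i j) + (\<Sum>i\<in>C. a i j)"
      using fin finC disj by (simp add: sum.union_disjoint)
    ultimately show ?thesis by (simp add: algebra_simps)
  qed
  ultimately show ?thesis by blast
qed

section \<open>Induction on the rank\<close>

text \<open>Some residue vector occurs \<open>p\<close> times, and \<open>p\<close> equal vectors
  sum to zero. This serves for primes too small for the expansion argument.\<close>

lemma pigeonhole_zero_sum: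
  fixes a :: "'i \<Rightarrow> 'j \<Rightarrow> int"
  assumes "p > 0" "finite J" "finite I" "p ^ card J * p \<le> card I"
  shows "\<exists>T\<subseteq>I. card T = p \<and> (\<forall>j\<in>J. int p dvd (\<Sum>i\<in>T. a i j))"
proof -
  define f where "f i = (\<lambda>j\<in>J. a i j mod int p)" for i
  have f: "f i \<in> vecs p J" for i using assms(1) by (auto simp: f_def vecs_def)
  have "\<exists>v\<in>vecs p J. p \<le> card {i\<in>I. f i = v}"
  proof (rule ccontr)
    assume "\<not> ?thesis"
    then have "(\<Sum>v\<in>vecs p J. card {i\<in>I. f i = v}) \<le> (\<Sum>v\<in>vecs p J. p - 1)"
      by (intro sum_mono) force
    moreover have "(\<Sum>v\<in>vecs p J. \<Sum>i\<in>{i\<in>I. f i = v}. 1) = (\<Sum>i\<in>I. 1::nat)"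
      by (rule sum.group) (use assms f in auto)
    ultimately have "card I \<le> p ^ card J * (p - 1)"
      using assms(2) by (simp add: card_vecs)
    also have "\<dots> < p ^ card J * p" using assms(1) by simp
    finally show False using assms(4) by simp
  qed
  then obtain v where "p \<le> card {i\<in>I. f i = v}" by blast
  then obtain T where T: "T \<subseteq> {i\<in>I. f i = v}" "card T = p"
    by (rule obtain_subset_with_card_n)
  have "int p dvd (\<Sum>i\<in>T. a i j)" if j: "j \<in> J" for j
  proof -
    have "a i j mod int p = v j" if "i \<in> T" for i
      using T(1) that j by (auto simp: f_def)
    then have "(\<Sum>i\<in>T. a i j mod int p) = int p * v j" using T(2) by simp
    moreover have "(\<Sum>i\<in>T. a i j) mod int p = (\<Sum>i\<in>T. a i j mod int p) mod int p"
      by (simp add: mod_sum_eq)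
    ultimately show ?thesis by (simp add: dvd_eq_mod_eq_0)
  qed
  then show ?thesis using T by blast
qed

text \<open>Summing the hyperplane equation over the \<open>p\<close> indices removes
  \<open>c\<close>. The coordinates other than \<open>k\<close> vanish by assumption, and
  \<open>u k\<close> is invertible modulo \<open>p\<close>.\<close>

lemma zero_sum_in_hyperplane:
  fixes a :: "'i \<Rightarrow> 'j \<Rightarrow> int"
  assumes "prime p" "finite J" "u \<in> vecs p J" "k \<in> J" "u k \<noteq> 0"
    and T: "card T = p" "\<And>i. i \<in> T \<Longrightarrow> int p dvd dotp J u (a i) - c"
    and zs: "\<And>j. j \<in> J - {k} \<Longrightarrow> int p dvd (\<Sum>i\<in>T. a i j)"
  shows "int p dvd (\<Sum>i\<in>T. a i k)"
proof -
  have "int p dvd (\<Sum>i\<in>T. dotp J u (a i) - c)" using T(2) by (intro dvd_sum)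
  also have "(\<Sum>i\<in>T. dotp J u (a i) - c) = (\<Sum>j\<in>J. u j * (\<Sum>i\<in>T. a i j)) - int p * c"
  proof -
    have "(\<Sum>i\<in>T. dotp J u (a i)) = (\<Sum>j\<in>J. \<Sum>i\<in>T. u j * a i j)"
      unfolding dotp_def by (rule sum.swap)
    then show ?thesis using T(1) by (simp add: sum_subtractf sum_distrib_left)
  qed
  finally have "int p dvd (\<Sum>j\<in>J. u j * (\<Sum>i\<in>T. a i j)) - int p * c + int p * c"
    by (intro dvd_add) auto
  then have "int p dvd (\<Sum>j\<in>J. u j * (\<Sum>i\<in>T. a i j))" by simp
  also have "(\<Sum>j\<in>J. u j * (\<Sum>i\<in>T. a i j)) = u k * (\<Sum>i\<in>T. a i k) + (\<Sum>j\<in>J - {k}. u j * (\<Sum>i\<in>T. a i j))"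
    using assms by (intro sum.remove) auto
  finally have "int p dvd u k * (\<Sum>i\<in>T. a i k) + (\<Sum>j\<in>J - {k}. u j * (\<Sum>i\<in>T. a i j))" .
  moreover have "int p dvd (\<Sum>j\<in>J - {k}. u j * (\<Sum>i\<in>T. a i j))"
    by (intro dvd_sum dvd_mult zs)
  ultimately have "int p dvd u k * (\<Sum>i\<in>T. a i k)"
    by (simp only: dvd_add_left_iff)
  moreover have "\<not> int p dvd u k"
  proof -
    have "0 \<le> u k" "u k < int p" using assms(3,4) by (auto simp: vecs_def PiE_iff)
    then show ?thesis using assms(5) zdvd_not_zless by simp
  qed
  ultimately show ?thesis
    using assms(1) prime_dvd_mult_iff[of "int p"] by auto
qed

text \<open>Induction on the rank: a hyperplane with many elements allows one coordinate to be
  dropped, and otherwise the sequence is spread. \<open>R\<close> stays fixed while the rank drops,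
  so the base of the power is the same throughout.\<close>

lemma prime_length_zero_sum:
  fixes a :: "'i \<Rightarrow> 'j \<Rightarrow> int"
  assumes "prime p" "p \<le> 2 ^ l" "finite J" "card J \<le> R" "finite I"
    and "(4608 * R * l) ^ card J * p \<le> card I"
  shows "\<exists>T\<subseteq>I. card T = p \<and> (\<forall>j\<in>J. int p dvd (\<Sum>i\<in>T. a i j))"
  using assms(3-6)
proof (induction "card J" arbitrary: J I)
  case 0
  then have "J = {}" "p \<le> card I" by auto
  moreover obtain T where "T \<subseteq> I" "card T = p"
    using \<open>p \<le> card I\<close> by (rule obtain_subset_with_card_n)
  ultimately show ?case by auto
next
  case (Suc n)
  have p: "p > 0" using assms(1) by (rule prime_gt_0_nat)
  have l: "l > 0" using prime_gt_1_nat[OF assms(1)] assms(2) by (cases l) auto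
  have R: "R > 0" using Suc.hyps(2) Suc.prems(2) by linarith
  define m where "m = R * l"
  \<comment> \<open>The length required by the induction hypothesis in rank
    \<open>n\<close>.\<close>
  define H where "H = (4608 * m) ^ n * p"
  have m: "m > 0" using l R by (simp add: m_def)
  have Hp: "p \<le> H" using m by (simp add: H_def)
  have cI: "4608 * (m * H) \<le> card I"
    using Suc.prems(4) unfolding Suc.hyps(2)[symmetric] by (simp add: H_def m_def algebra_simps)
  show ?case
  proof (cases "p < 16 * m")
    case True
    then have "p ^ card J \<le> (4608 * R * l) ^ card J"
      by (intro power_mono) (auto simp: m_def)
    then have "p ^ card J * p \<le> (4608 * R * l) ^ card J * p" by (rule mult_le_mono1)
    then have "p ^ card J * p \<le> card I" using Suc.prems(4) by (rule order_trans)
    then show ?thesis by (intro pigeonhole_zero_sum p Suc.prems)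
  next
    case False
    show ?thesis
    proof (cases "\<exists>u\<in>vecs p J. \<exists>c. (\<exists>j\<in>J. u j \<noteq> 0) \<and> H < card {i\<in>I. int p dvd dotp J u (a i) - c}")
      case True
      then obtain u c k where u: "u \<in> vecs p J" "k \<in> J" "u k \<noteq> 0"
        and big: "H < card {i\<in>I. int p dvd dotp J u (a i) - c}" by blast
      let ?I = "{i\<in>I. int p dvd dotp J u (a i) - c}"
      have n: "n = card (J - {k})" using Suc.hyps(2) u(2) by simp
      have large: "(4608 * R * l) ^ card (J - {k}) * p \<le> card ?I"
        using big unfolding n[symmetric] by (simp add: H_def m_def mult.assoc)
      have rank: "card (J - {k}) \<le> R" using n Suc.hyps(2) Suc.prems(2) by linarith
      have "finite (J - {k})" "finite ?I" using Suc.prems(1,3) by simp_all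
      then obtain T where T: "T \<subseteq> ?I" "card T = p" "\<forall>j\<in>J - {k}. int p dvd (\<Sum>i\<in>T. a i j)"
        using Suc.hyps(1)[OF n _ rank _ large] by blast
      have "int p dvd dotp J u (a i) - c" if "i \<in> T" for i using T(1) that by blast
      then have "int p dvd (\<Sum>i\<in>T. a i k)"
        using zero_sum_in_hyperplane[OF assms(1) Suc.prems(1) u T(2)] T(3) by blast
      then have "\<forall>j\<in>J. int p dvd (\<Sum>i\<in>T. a i j)" using T(3) by blast
      then show ?thesis using T by blast
    next
      case nospread: False
      \<comment> \<open>Since \<open>4 K\<close> expansion steps double a set, \<open>p / 2 \<ge> 4 K R l\<close> steps multiply its size
          by at least \<open>2 ^ (R l) \<ge> p ^ card J\<close>.\<close>
      define K where "K = p div (16 * m)"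
      have pK: "p < 16 * m * (K + 1)"
        using m dividend_less_div_times[of "16 * m" p] by (simp add: K_def algebra_simps)
      have Kp: "16 * m * K \<le> p" unfolding K_def by (rule times_div_less_eq_dividend)
      have "K > 0" using False m by (simp add: K_def div_greater_zero_iff)
      then have "16 * m * (K + 1) \<le> 16 * m * (2 * K)" by (intro mult_le_mono2) simp
      with pK have "p < 16 * m * (2 * K)" by (rule less_le_trans)
      \<comment> \<open>The width \<open>L\<close> is \<open>256 * m\<close>, chosen because
        \<open>p < 32 * m * K\<close>.\<close>
      then have a1: "8 * p \<le> K * (256 * m)" by (simp add: algebra_simps)
      have "1 * p \<le> m * H" using Hp m by (intro mult_le_mono) auto
      \<comment> \<open>Here \<open>16 * 256 = 4096\<close>, and the term \<open>2 * p\<close> is at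
        most \<open>2 * (m * H)\<close>; the constant 4608 covers both.\<close>
      then have a2: "16 * (256 * m) * H + 2 * p \<le> card I" using cI by (simp add: algebra_simps)
      have "4 * K * (card J * l) \<le> 4 * K * m"
        unfolding m_def using Suc.prems(2) by (intro mult_le_mono) auto
      also have "\<dots> \<le> p div 2" using Kp by (simp add: algebra_simps)
      finally have a3: "4 * K * (card J * l) \<le> p div 2" .
      show ?thesis
        by (rule spread_zero_sum[OF p Suc.prems(1,3) _ _ a1 a2 assms(2) a3])
           (use Hp p m nospread in \<open>auto simp: not_less\<close>)
    qed
  qed
qed

section \<open>Olson's theorem\<close>

text \<open>A finite difference of order \<open>card A\<close> kills a polynomial of degree
  \<open>card K < card A\<close>. Pairing \<open>T\<close> with \<open>insert x T\<close> takes one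
  difference: expanding the product, the term with all factors of \<open>K\<close> cancels and the
  others have fewer factors depending on \<open>T\<close>.\<close>

lemma alternating_sum_prod_eq_0:
  fixes b :: "'k \<Rightarrow> 'i \<Rightarrow> 'a::comm_ring_1"
  assumes "finite A" "finite K" "card K < card A"
  shows "(\<Sum>T\<in>Pow A. (- 1) ^ card T * (\<Prod>k\<in>K. c k + (\<Sum>i\<in>T. b k i))) = 0"
  using assms
proof (induction A arbitrary: K c rule: finite_induct)
  case empty
  then show ?case by simp
next
  case (insert x A)
  define f where "f k T = c k + (\<Sum>i\<in>T. b k i)" for k T
  have fin: "finite T" if "T \<in> Pow A" for T using that insert.hyps finite_subset by blast
  have "(\<Sum>T\<in>Pow (insert x A). (- 1) ^ card T * (\<Prod>k\<in>K. f k T)) =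
     (\<Sum>T\<in>Pow A. (- 1) ^ card T * (\<Prod>k\<in>K. f k T)) +
     (\<Sum>T\<in>insert x ` Pow A. (- 1) ^ card T * (\<Prod>k\<in>K. f k T))"
    unfolding Pow_insert by (rule sum.union_disjoint) (use insert.hyps in auto)
  also have "(\<Sum>T\<in>insert x ` Pow A. (- 1) ^ card T * (\<Prod>k\<in>K. f k T)) =
     (\<Sum>T\<in>Pow A. (- 1) ^ card (insert x T) * (\<Prod>k\<in>K. f k (insert x T)))"
    by (subst sum.reindex) (use insert.hyps in \<open>auto intro!: inj_onI simp: o_def\<close>)
  also have "\<dots> = (\<Sum>T\<in>Pow A. - ((- 1) ^ card T * (\<Sum>X\<in>Pow K. (\<Prod>k\<in>X. f k T) * (\<Prod>k\<in>K - X. b k x))))"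
  proof (rule sum.cong)
    fix T assume T: "T \<in> Pow A"
    then have "x \<notin> T" using insert.hyps by blast
    then have "card (insert x T) = Suc (card T)" "f k (insert x T) = f k T + b k x" for k
      using fin[OF T] by (simp_all add: f_def algebra_simps)
    then show "(- 1) ^ card (insert x T) * (\<Prod>k\<in>K. f k (insert x T)) =
        - ((- 1) ^ card T * (\<Sum>X\<in>Pow K. (\<Prod>k\<in>X. f k T) * (\<Prod>k\<in>K - X. b k x)))"
      by (simp add: prod_add[OF insert.prems(1)])
  qed simp
  also have "\<dots> = (\<Sum>T\<in>Pow A. - ((- 1) ^ card T * ((\<Prod>k\<in>K. f k T) +
      (\<Sum>X\<in>Pow K - {K}. (\<Prod>k\<in>X. f k T) * (\<Prod>k\<in>K - X. b k x)))))"
    by (subst sum.remove[of "Pow K" K]) (use insert.prems in simp_all)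
  also have "(\<Sum>T\<in>Pow A. (- 1) ^ card T * (\<Prod>k\<in>K. f k T)) + \<dots> =
      - (\<Sum>T\<in>Pow A. \<Sum>X\<in>Pow K - {K}. (\<Prod>k\<in>K - X. b k x) * ((- 1) ^ card T * (\<Prod>k\<in>X. f k T)))"
    by (simp add: sum_negf sum.distrib sum_distrib_left algebra_simps sum_subtractf)
  also have "\<dots> = - (\<Sum>X\<in>Pow K - {K}. (\<Prod>k\<in>K - X. b k x) * (\<Sum>T\<in>Pow A. (- 1) ^ card T * (\<Prod>k\<in>X. f k T)))"
    by (subst sum.swap) (simp add: sum_distrib_left)
  also have "\<dots> = - (\<Sum>X\<in>Pow K - {K}. (\<Prod>k\<in>K - X. b k x) * 0)"
  proof -
    have "(\<Sum>T\<in>Pow A. (- 1) ^ card T * (\<Prod>k\<in>X. f k T)) = 0" if X: "X \<in> Pow K - {K}" for X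
    proof -
      have "card X < card K" using X insert.prems by (auto intro: psubset_card_mono)
      moreover have "card K \<le> card A" using insert.prems insert.hyps by simp
      moreover have "finite X" using X insert.prems finite_subset by blast
      ultimately show ?thesis unfolding f_def by (intro insert.IH) auto
    qed
    then show ?thesis by simp
  qed
  finally show ?case by (simp add: f_def)
qed

section \<open>Binomial coefficients modulo a prime\<close>

text \<open>\<open>p ^ k\<close> divides \<open>j * (p ^ k choose j)\<close>. Were the binomial
  coefficient prime to \<open>p\<close>, then \<open>p ^ k\<close> would divide the smaller number
  \<open>j\<close>.\<close>

lemma prime_dvd_binomial_prime_power:
  assumes "prime (p::nat)" "0 < j" "j < p ^ k"
  shows "p dvd (p ^ k choose j)"
proof (rule ccontr)
  assume "\<not> p dvd (p ^ k choose j)"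
  then have "coprime (p ^ k) (p ^ k choose j)"
    using assms(1) by (simp add: prime_imp_coprime coprime_power_left_iff)
  moreover have "p ^ k dvd j * (p ^ k choose j)"
  proof -
    obtain i where j: "j = Suc i" using assms(2) by (cases j) auto
    have "Suc (p ^ k - 1) = p ^ k" using assms(3) by linarith
    then have "Suc i * (p ^ k choose Suc i) = p ^ k * ((p ^ k - 1) choose i)"
      using Suc_times_binomial_eq[of "p ^ k - 1" i] by (simp only: mult.commute)
    then show ?thesis by (simp only: j dvd_triv_left)
  qed
  ultimately have "p ^ k dvd j" by (simp add: coprime_dvd_mult_left_iff)
  then have "p ^ k \<le> j" using assms(2) by (rule dvd_imp_le)
  then show False using assms(3) by simp
qed

text \<open>In Vandermonde's identity only the term \<open>i = 0\<close> survives modulo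
  \<open>p\<close>.\<close>

lemma binomial_add_prime_power_cong:
  assumes "prime (p::nat)" "j < p ^ k"
  shows "[p ^ k + x choose j = x choose j] (mod p)"
proof -
  have "(p ^ k + x choose j) = (\<Sum>i\<le>j. (p ^ k choose i) * (x choose (j - i)))"
    by (rule vandermonde [symmetric])
  also have "\<dots> = (x choose j) + (\<Sum>i\<in>{..j} - {0}. (p ^ k choose i) * (x choose (j - i)))"
    by (subst sum.remove[of _ 0]) auto
  finally have eq: "(p ^ k + x choose j) = \<dots>" .
  have "p dvd (\<Sum>i\<in>{..j} - {0}. (p ^ k choose i) * (x choose (j - i)))"
    using assms by (intro dvd_sum dvd_mult2 prime_dvd_binomial_prime_power) auto
  then show ?thesis unfolding eq by (simp only: cong_add_lcancel_0_nat cong_0_iff)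
qed

lemma binomial_add_mult_prime_power_cong:
  assumes "prime (p::nat)" "j < p ^ k"
  shows "[p ^ k * y + x choose j = x choose j] (mod p)"
proof (induction y)
  case (Suc y)
  have "[p ^ k + (p ^ k * y + x) choose j = p ^ k * y + x choose j] (mod p)"
    by (rule binomial_add_prime_power_cong[OF assms])
  from cong_trans[OF this Suc] show ?case by (simp add: add.assoc)
qed simp

text \<open>By periodicity, \<open>x\<close> may be replaced by its residue \<open>z\<close> modulo
  \<open>q = p ^ k\<close>. For \<open>z = 0\<close> the coefficient is 1; otherwise
  \<open>z + (q - 1) = q + (z - 1)\<close> reduces it to \<open>z - 1 choose (q - 1)\<close>, which
  is 0.\<close>

lemma binomial_prime_power_indicator:
  assumes "prime (p::nat)"
  shows "[x + (p ^ k - 1) choose (p ^ k - 1) = (if p ^ k dvd x then 1 else 0)] (mod p)"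
proof -
  let ?q = "p ^ k" and ?z = "x mod p ^ k"
  have q: "?q > 0" using assms prime_gt_0_nat by simp
  have eq: "x + (?q - 1) = ?q * (x div ?q) + (?z + (?q - 1))"
    unfolding add.assoc[symmetric] by simp
  have lt: "?q - 1 < ?q" using q by simp
  then have 1: "[x + (?q - 1) choose (?q - 1) = ?z + (?q - 1) choose (?q - 1)] (mod p)"
    using binomial_add_mult_prime_power_cong[OF assms lt, of "x div ?q" "?z + (?q - 1)"]
    by (simp only: eq[symmetric])
  show ?thesis
  proof (cases "?z = 0")
    case True
    then show ?thesis using 1 by (simp add: dvd_eq_mod_eq_0)
  next
    case False
    have "?z < ?q" using q by simp
    then have e: "?z + (?q - 1) = ?q + (?z - 1)" "?z - 1 < ?q - 1" using False by linarith+
    then have "[?z + (?q - 1) choose (?q - 1) = 0] (mod p)"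
      using binomial_add_prime_power_cong[OF assms lt, of "?z - 1"]
      by (simp only: e(1) binomial_eq_0[OF e(2)])
    with 1 have "[x + (?q - 1) choose (?q - 1) = 0] (mod p)" by (rule cong_trans)
    then show ?thesis using False by (simp add: dvd_eq_mod_eq_0)
  qed
qed

text \<open>Writes the binomial coefficient, up to a factorial, as a product of \<open>m\<close>
  linear factors with integer coefficients.\<close>

lemma fact_mult_binomial_rising:
  "fact m * (x + m choose m) = (\<Prod>k\<in>{1..m}. x + k)"
proof -
  have "fact (x + m) = fact x * (\<Prod>k\<in>{1..m}. x + k)"
    by (induction m) (auto simp: algebra_simps)
  moreover have "fact x * fact m * (x + m choose m) = fact (x + m)"
    using binomial_fact_lemma[of m "x + m"] by (simp add: mult.commute)
  ultimately have "fact x * (fact m * (x + m choose m)) = fact x * (\<Prod>k\<in>{1..m}. x + k)" by (simp add: mult.assoc)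
  then show ?thesis by (rule iffD1[OF mult_left_cancel[OF fact_nonzero]])
qed

text \<open>
  Olson's theorem for \<open>C\<^sub>q\<^sup>r\<close>, \<open>q = p\<^sup>k\<close>. Modulo \<open>p\<close>, the product \<open>F T\<close> of the binomial coefficients
  is the indicator of \<open>T\<close> having zero sum; but up to a constant it is a polynomial of degree at
  most \<open>r (q - 1)\<close> in the indicator variables of \<open>T\<close>, so its alternating sum over all subsets of
  a larger set vanishes, although the empty set alone contributes 1.
\<close>

lemma prime_power_zero_sum:
  fixes a :: "'i \<Rightarrow> 'j \<Rightarrow> int"
  assumes p: "prime p" and fin: "finite J" "finite I" and card: "card J * (p ^ k - 1) < card I"
  shows "\<exists>T\<subseteq>I. T \<noteq> {} \<and> (\<forall>j\<in>J. int (p ^ k) dvd (\<Sum>i\<in>T. a i j))"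
proof (rule ccontr)
  assume no: "\<not> ?thesis"
  define q where "q = p ^ k"
  have q: "q > 0" using p prime_gt_0_nat by (simp add: q_def)
  have no': "\<exists>j\<in>J. \<not> int q dvd (\<Sum>i\<in>T. a i j)" if "T \<subseteq> I" "T \<noteq> {}" for T
    using no that unfolding q_def by blast
  \<comment> \<open>Nonnegative representatives, so that binomial coefficients of their sums make
    sense in the naturals.\<close>
  define b where "b i j = nat (a i j mod int q)" for i j
  define s where "s T j = (\<Sum>i\<in>T. b i j)" for T j
  have s_dvd: "q dvd s T j \<longleftrightarrow> int q dvd (\<Sum>i\<in>T. a i j)" for T j
  proof -
    have "int (s T j) = (\<Sum>i\<in>T. a i j mod int q)" using q by (simp add: s_def b_def)
    then have "int (s T j) mod int q = (\<Sum>i\<in>T. a i j) mod int q" by (simp add: mod_sum_eq)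
    then have "int q dvd int (s T j) \<longleftrightarrow> int q dvd (\<Sum>i\<in>T. a i j)" by (simp add: dvd_eq_mod_eq_0)
    then show ?thesis by simp
  qed
  define F where "F T = (\<Prod>j\<in>J. (s T j + (q - 1)) choose (q - 1))" for T
  have F: "[int (F T) = (if T = {} then 1 else 0)] (mod int p)" if "T \<in> Pow I" for T
  proof -
    have "[F T = (\<Prod>j\<in>J. if q dvd s T j then 1 else 0)] (mod p)"
      unfolding F_def q_def by (intro cong_prod binomial_prime_power_indicator p)
    also have "(\<Prod>j\<in>J. if q dvd s T j then 1 else 0) = (if T = {} then 1 else (0::nat))"
    proof (cases "T = {}")
      case True
      then show ?thesis by (simp add: s_def)
    next
      case False
      moreover have "T \<subseteq> I" using that by blast
      ultimately obtain j where "j \<in> J" "\<not> q dvd s T j" using no' unfolding s_dvd by blast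
      then have "(\<Prod>j\<in>J. if q dvd s T j then 1 else (0::nat)) = 0"
        by (intro prod_zero fin(1) bexI[of _ j]) simp_all
      then show ?thesis using False by (simp only: if_False)
    qed
    finally have "[int (F T) = int (if T = {} then 1 else 0)] (mod int p)" by (simp only: cong_int_iff)
    then show ?thesis by (simp split: if_splits)
  qed
  \<comment> \<open>One linear factor for each pair, hence a polynomial of degree
    \<open>card J * (q - 1)\<close>.\<close>
  let ?K = "J \<times> {1..q - 1}"
  have prod: "(\<Prod>(j, m)\<in>?K. int m + (\<Sum>i\<in>T. int (b i j))) = fact (q - 1) ^ card J * int (F T)" for T
  proof -
    have "(\<Prod>(j, m)\<in>?K. int m + (\<Sum>i\<in>T. int (b i j))) = (\<Prod>j\<in>J. \<Prod>m\<in>{1..q - 1}. int (s T j + m))"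
      by (simp add: prod.cartesian_product s_def add.commute)
    also have "\<dots> = (\<Prod>j\<in>J. int (\<Prod>m\<in>{1..q - 1}. s T j + m))" by (simp only: of_nat_prod)
    also have "\<dots> = (\<Prod>j\<in>J. int (fact (q - 1) * (s T j + (q - 1) choose (q - 1))))"
      by (simp only: fact_mult_binomial_rising)
    also have "\<dots> = fact (q - 1) ^ card J * int (F T)"
      by (simp only: F_def of_nat_mult of_nat_fact prod.distrib prod_constant of_nat_prod)
    finally show ?thesis .
  qed
  have "card ?K < card I" using card by (simp add: card_cartesian_product q_def)
  then have "(\<Sum>T\<in>Pow I. (- 1) ^ card T * (\<Prod>(j, m)\<in>?K. int m + (\<Sum>i\<in>T. int (b i j)))) = 0"
    using alternating_sum_prod_eq_0[of I ?K "\<lambda>(j, m). int m" "\<lambda>(j, m) i. int (b i j)"] fin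
    by (simp only: case_prod_unfold finite_cartesian_product finite_atLeastAtMost simp_thms)
  also have "(\<Sum>T\<in>Pow I. (- 1) ^ card T * (\<Prod>(j, m)\<in>?K. int m + (\<Sum>i\<in>T. int (b i j)))) =
      fact (q - 1) ^ card J * (\<Sum>T\<in>Pow I. (- 1) ^ card T * int (F T))"
    unfolding prod sum_distrib_left by (intro sum.cong refl mult.left_commute)
  \<comment> \<open>The factorials may be divisible by \<open>p\<close>, so they are cancelled over
    the integers before reduction modulo \<open>p\<close>.\<close>
  finally have zero: "(\<Sum>T\<in>Pow I. (- 1) ^ card T * int (F T)) = 0"
    by (simp only: mult_eq_0_iff power_eq_0_iff fact_nonzero simp_thms)
  have "[(\<Sum>T\<in>Pow I. (- 1) ^ card T * int (F T)) = (\<Sum>T\<in>Pow I. (- 1) ^ card T * (if T = {} then 1 else 0))] (mod int p)"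
    by (intro cong_sum cong_mult cong_refl F)
  also have "(\<Sum>T\<in>Pow I. (- 1) ^ card T * (if T = {} then 1 else 0)) = (1::int)"
  proof -
    have "(\<Sum>T\<in>Pow I. (- 1) ^ card T * (if T = {} then 1 else 0)) = (\<Sum>T\<in>Pow I. if T = {} then 1 else (0::int))"
      by (intro sum.cong) auto
    then show ?thesis using fin by simp
  qed
  finally have "[1 = 0] (mod int p)" unfolding zero by (rule cong_sym)
  then have "int p dvd 1" by (simp only: cong_0_iff)
  then show False using prime_gt_1_nat[OF p] by (simp add: zdvd1_eq)
qed

section \<open>Short zero-sum subsequences\<close>

text \<open>
  In these terms \<open>zero_sum_bound J n n L\<close> says \<open>\<eta>(C\<^sub>n\<^sup>r) \<le> L\<close> for \<open>r = card J\<close>, and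
  \<open>zero_sum_bound J n L L\<close> says \<open>D(C\<^sub>n\<^sup>r) \<le> L\<close>.
\<close>

definition zero_sum_bound :: "'j set \<Rightarrow> nat \<Rightarrow> nat \<Rightarrow> nat \<Rightarrow> bool" where
  "zero_sum_bound J n l L \<longleftrightarrow>
     (\<forall>I (a :: nat \<Rightarrow> 'j \<Rightarrow> int). finite I \<and> L \<le> card I \<longrightarrow>
        (\<exists>T\<subseteq>I. T \<noteq> {} \<and> card T \<le> l \<and> (\<forall>j\<in>J. int n dvd (\<Sum>i\<in>T. a i j))))"

lemma zero_sum_boundE:
  fixes a :: "nat \<Rightarrow> 'j \<Rightarrow> int"
  assumes "zero_sum_bound J n l L" "finite I" "L \<le> card I"
  obtains T where "T \<subseteq> I" "T \<noteq> {}" "card T \<le> l" "\<And>j. j \<in> J \<Longrightarrow> int n dvd (\<Sum>i\<in>T. a i j)"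
  using assms unfolding zero_sum_bound_def by meson

lemma zero_sum_bound_mono:
  "zero_sum_bound J n l L \<Longrightarrow> l \<le> l' \<Longrightarrow> L \<le> L' \<Longrightarrow> zero_sum_bound J n l' L'"
  unfolding zero_sum_bound_def by (meson order_trans)

text \<open>Greedy choice: \<open>k\<close> blocks use up at most \<open>l * k\<close> indices, and
  the remaining \<open>L\<close> or more yield another block.\<close>

lemma disjoint_zero_sums:
  fixes a :: "nat \<Rightarrow> 'j \<Rightarrow> int"
  assumes "zero_sum_bound J n l L" "finite I" "l * k + L \<le> card I"
  shows "\<exists>B :: nat \<Rightarrow> nat set. disjoint_family_on B {..<k} \<and>
           (\<forall>t<k. B t \<subseteq> I \<and> B t \<noteq> {} \<and> card (B t) \<le> l \<and> (\<forall>j\<in>J. int n dvd (\<Sum>i\<in>B t. a i j)))"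
  using assms(3)
proof (induction k)
  case 0
  then show ?case by (simp add: disjoint_family_on_def)
next
  case (Suc k)
  have "l * k + L \<le> card I" using Suc.prems by simp
  from Suc.IH[OF this] obtain B :: "nat \<Rightarrow> nat set" where dis: "disjoint_family_on B {..<k}"
    and B: "\<forall>t<k. B t \<subseteq> I \<and> B t \<noteq> {} \<and> card (B t) \<le> l \<and> (\<forall>j\<in>J. int n dvd (\<Sum>i\<in>B t. a i j))"
    by blast
  define U where "U = (\<Union>t<k. B t)"
  have U: "U \<subseteq> I" using B unfolding U_def by blast
  then have finU: "finite U" using assms(2) by (rule finite_subset)
  have "card U \<le> (\<Sum>t<k. card (B t))" unfolding U_def by (rule card_UN_le) simp
  also have "\<dots> \<le> (\<Sum>t<k. l)" using B by (intro sum_mono) auto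
  finally have "card U \<le> k * l" by simp
  then have "card U + L \<le> card I" using Suc.prems by (simp add: algebra_simps)
  then have "L \<le> card (I - U)" using U finU by (simp add: card_Diff_subset)
  with assms(1) finite_Diff[OF assms(2)]
  obtain T where T: "T \<subseteq> I - U" "T \<noteq> {}" "card T \<le> l" "\<And>j. j \<in> J \<Longrightarrow> int n dvd (\<Sum>i\<in>T. a i j)"
    by (rule zero_sum_boundE[where a = a]) blast
  define B' where "B' = B(k := T)"
  have B't: "B' t = B t" if "t < k" for t
    using that by (simp add: B'_def)
  have "B' k = T" by (simp add: B'_def)
  have TU: "T \<inter> B t = {}" if "t < k" for t using T(1) that by (auto simp: U_def)
  have "disjoint_family_on B' {..<Suc k}"
    unfolding disjoint_family_on_def
  proof (intro ballI impI)
    fix s t assume st: "s \<in> {..<Suc k}" "t \<in> {..<Suc k}" "s \<noteq> t"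
    consider "s = k" "t < k" | "t = k" "s < k" | "s < k" "t < k" using st by fastforce
    then show "B' s \<inter> B' t = {}"
    proof cases
      case 1
      then show ?thesis using TU[of t] by (simp add: B't \<open>B' k = T\<close>)
    next
      case 2
      then show ?thesis using TU[of s] by (simp add: B't \<open>B' k = T\<close> Int_commute)
    next
      case 3
      then show ?thesis using dis st(3) by (simp add: B't disjoint_family_on_def)
    qed
  qed
  moreover have "B' t \<subseteq> I \<and> B' t \<noteq> {} \<and> card (B' t) \<le> l \<and> (\<forall>j\<in>J. int n dvd (\<Sum>i\<in>B' t. a i j))"
    if "t < Suc k" for t
  proof (cases "t = k")
    case True
    then show ?thesis using T \<open>B' k = T\<close> by auto
  next
    case False
    then have "t < k" using that by simp
    then show ?thesis using B B't by simp
  qed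
  ultimately show ?case by blast
qed

text \<open>Take \<open>L'\<close> disjoint blocks with sums divisible by \<open>m\<close>, divide
  these sums by \<open>m\<close>, and apply the second bound to the quotients. The union of the
  selected blocks is the required set.\<close>

lemma zero_sum_bound_mult:
  fixes J :: "'j set"
  assumes "zero_sum_bound J m l L" "zero_sum_bound J n l' L'" "m > 0"
  shows "zero_sum_bound J (m * n) (l * l') (l * L' + L)"
  unfolding zero_sum_bound_def
proof (intro allI impI, elim conjE)
  fix I :: "nat set" and a :: "nat \<Rightarrow> 'j \<Rightarrow> int"
  assume I: "finite I" "l * L' + L \<le> card I"
  obtain B :: "nat \<Rightarrow> nat set" where dis: "disjoint_family_on B {..<L'}"
    and B: "\<forall>t<L'. B t \<subseteq> I \<and> B t \<noteq> {} \<and> card (B t) \<le> l \<and> (\<forall>j\<in>J. int m dvd (\<Sum>i\<in>B t. a i j))"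
    using disjoint_zero_sums[OF assms(1) I] by blast
  obtain S where S: "S \<subseteq> {..<L'}" "S \<noteq> {}" "card S \<le> l'"
    and zs: "\<And>j. j \<in> J \<Longrightarrow> int n dvd (\<Sum>t\<in>S. (\<Sum>i\<in>B t. a i j) div int m)"
    by (rule zero_sum_boundE[OF assms(2), of "{..<L'}" "\<lambda>t j. (\<Sum>i\<in>B t. a i j) div int m"]) simp_all
  have finS: "finite S" using S(1) finite_lessThan by (rule finite_subset)
  have S_lt: "t < L'" if "t \<in> S" for t using S that by auto
  have finB: "finite (B t)" if "t \<in> S" for t
    using B S_lt[OF that] by (intro finite_subset[OF _ I(1)]) simp
  let ?T = "\<Union>t\<in>S. B t"
  have "?T \<subseteq> I" using B S_lt by blast
  moreover have "?T \<noteq> {}"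
  proof -
    obtain t where "t \<in> S" using S(2) by blast
    then have "B t \<noteq> {}" "B t \<subseteq> ?T" using B S_lt by auto
    then show ?thesis by blast
  qed
  moreover have "card ?T \<le> l * l'"
  proof -
    have "card ?T \<le> (\<Sum>t\<in>S. card (B t))" by (rule card_UN_le[OF finS])
    also have "\<dots> \<le> (\<Sum>t\<in>S. l)" using B S_lt by (intro sum_mono) auto
    also have "\<dots> \<le> l * l'" using S(3) by simp
    finally show ?thesis .
  qed
  moreover have "int (m * n) dvd (\<Sum>i\<in>?T. a i j)" if j: "j \<in> J" for j
  proof -
    have "(\<Sum>i\<in>?T. a i j) = (\<Sum>t\<in>S. \<Sum>i\<in>B t. a i j)"
    proof (rule sum.UNION_disjoint[OF finS])
      show "\<forall>t\<in>S. finite (B t)" using finB by blast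
      show "\<forall>s\<in>S. \<forall>t\<in>S. s \<noteq> t \<longrightarrow> B s \<inter> B t = {}"
        using dis S(1) unfolding disjoint_family_on_def by blast
    qed
    also have "\<dots> = (\<Sum>t\<in>S. int m * ((\<Sum>i\<in>B t. a i j) div int m))"
      using B S_lt j by (intro sum.cong refl) simp
    also have "\<dots> = int m * (\<Sum>t\<in>S. (\<Sum>i\<in>B t. a i j) div int m)"
      by (simp add: sum_distrib_left)
    finally show ?thesis using zs[OF j] assms(3) by simp
  qed
  ultimately show "\<exists>T\<subseteq>I. T \<noteq> {} \<and> card T \<le> l * l' \<and> (\<forall>j\<in>J. int (m * n) dvd (\<Sum>i\<in>T. a i j))"
    by blast
qed

lemma zero_sum_bound_prime:
  fixes J :: "'j set"
  assumes "prime p" "p \<le> 2 ^ l" "finite J"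
  shows "zero_sum_bound J p p (p * (4608 * card J * l) ^ card J)"
  unfolding zero_sum_bound_def
proof (intro allI impI, elim conjE)
  fix I :: "nat set" and a :: "nat \<Rightarrow> 'j \<Rightarrow> int"
  assume I: "finite I" "p * (4608 * card J * l) ^ card J \<le> card I"
  then have "(4608 * card J * l) ^ card J * p \<le> card I" by (simp only: mult.commute)
  then obtain T where T: "T \<subseteq> I" "card T = p" "\<forall>j\<in>J. int p dvd (\<Sum>i\<in>T. a i j)"
    using prime_length_zero_sum[OF assms(1,2,3) order_refl I(1)] by blast
  moreover have "T \<noteq> {}" using T(2) prime_gt_0_nat[OF assms(1)] by auto
  ultimately show "\<exists>T\<subseteq>I. T \<noteq> {} \<and> card T \<le> p \<and> (\<forall>j\<in>J. int p dvd (\<Sum>i\<in>T. a i j))"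
    by (metis order_refl)
qed

lemma zero_sum_bound_prime_power:
  fixes J :: "'j set"
  assumes "prime p" "finite J"
  shows "zero_sum_bound J (p ^ k) (card J * (p ^ k - 1) + 1) (card J * (p ^ k - 1) + 1)"
  unfolding zero_sum_bound_def
proof (intro allI impI, elim conjE)
  fix I :: "nat set" and a :: "nat \<Rightarrow> 'j \<Rightarrow> int"
  assume I: "finite I" "card J * (p ^ k - 1) + 1 \<le> card I"
  \<comment> \<open>Cutting down to this exact length makes the bound on \<open>card T\<close>
    automatic.\<close>
  obtain I' where I': "I' \<subseteq> I" "card I' = card J * (p ^ k - 1) + 1" "finite I'"
    using I(2) by (rule obtain_subset_with_card_n)
  have "card J * (p ^ k - 1) < card I'" using I'(2) by simp
  then obtain T where T: "T \<subseteq> I'" "T \<noteq> {}" "\<forall>j\<in>J. int (p ^ k) dvd (\<Sum>i\<in>T. a i j)"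
    using prime_power_zero_sum[OF assms I'(3), where k = k and a = a] by blast
  have "card T \<le> card J * (p ^ k - 1) + 1"
    using card_mono[OF I'(3) T(1)] I'(2) by simp
  with T subset_trans[OF T(1) I'(1)]
  show "\<exists>T\<subseteq>I. T \<noteq> {} \<and> card T \<le> card J * (p ^ k - 1) + 1 \<and>
      (\<forall>j\<in>J. int (p ^ k) dvd (\<Sum>i\<in>T. a i j))"
    by (intro exI[of _ T] conjI)
qed

text \<open>Splitting a prime \<open>p\<close> off \<open>m = m' * p\<close> costs
  \<open>m' * (p * g) = m * g\<close>. Since \<open>m'\<close> is at most \<open>m / 2\<close>,
  these costs form a series dominated by a geometric one, with total at most
  \<open>2 * m * g\<close>.\<close>

lemma zero_sum_bound_composite:
  fixes J :: "'j set"
  assumes "m > 0" "g > 0" "\<And>p. prime p \<Longrightarrow> p dvd m \<Longrightarrow> zero_sum_bound J p p (p * g)"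
  shows "zero_sum_bound J m m (2 * m * g)"
  using assms(1,3)
proof (induction m rule: less_induct)
  case (less m)
  show ?case
  proof (cases "m = 1")
    case True
    have "zero_sum_bound J 1 1 1"
      unfolding zero_sum_bound_def
    proof (intro allI impI, elim conjE)
      fix I :: "nat set" and a :: "nat \<Rightarrow> 'j \<Rightarrow> int"
      assume "finite I" "1 \<le> card I"
      then obtain i where "i \<in> I" by fastforce
      then show "\<exists>T\<subseteq>I. T \<noteq> {} \<and> card T \<le> 1 \<and> (\<forall>j\<in>J. int 1 dvd (\<Sum>i\<in>T. a i j))"
        by (intro exI[of _ "{i}"]) auto
    qed
    then have "zero_sum_bound J 1 1 (2 * 1 * g)"
      by (rule zero_sum_bound_mono) (use assms(2) in simp_all)
    then show ?thesis unfolding True .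
  next
    case False
    then obtain p where p: "prime p" "p dvd m" using prime_factor_nat by blast
    obtain m' where "m = p * m'" using p(2) by (rule dvdE)
    then have m: "m = m' * p" by simp
    have "m' > 0" using less.prems(1) m by (intro Nat.gr0I) simp
    then have m': "m' > 0" "m' < m" using prime_gt_1_nat[OF p(1)] by (simp_all add: m)
    have "zero_sum_bound J m' m' (2 * m' * g)"
      using m' less.prems(2) by (intro less.IH) (auto simp: m)
    from zero_sum_bound_mult[OF this less.prems(2)[OF p] m'(1)]
    have "zero_sum_bound J m m (m' * (p * g) + 2 * m' * g)" by (simp only: m)
    moreover have "2 * m' * g \<le> m * g"
      using prime_ge_2_nat[OF p(1)] unfolding m by (intro mult_le_mono1) (simp add: mult.commute)
    then have "m' * (p * g) + 2 * m' * g \<le> 2 * m * g" by (simp add: m mult.assoc)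
    ultimately show ?thesis by (rule zero_sum_bound_mono[OF _ order_refl])
  qed
qed

lemma zero_sum_bound_large_prime_power:
  assumes "prime p" "finite J" "card J > 0" "m > 0" "l > 0" "p ^ k \<le> 2 ^ l"
    and "\<And>p'. prime p' \<Longrightarrow> p' dvd m \<Longrightarrow> p' \<le> p ^ k"
  shows "\<exists>l'. zero_sum_bound J (m * p ^ k) l'
           (m * (card J * (p ^ k - 1) + 1) + 2 * m * (4608 * card J * l) ^ card J)"
proof -
  have "zero_sum_bound J m m (2 * m * (4608 * card J * l) ^ card J)"
  proof (rule zero_sum_bound_composite)
    show "zero_sum_bound J p' p' (p' * (4608 * card J * l) ^ card J)" if "prime p'" "p' dvd m" for p'
      using that(1) order_trans[OF assms(7)[OF that] assms(6)] assms(2) by (rule zero_sum_bound_prime)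
  qed (use assms in simp_all)
  from zero_sum_bound_mult[OF this zero_sum_bound_prime_power[OF assms(1,2)] assms(4)]
  show ?thesis by blast
qed

section \<open>Large prime power divisors\<close>

text \<open>Let \<open>q\<close> be the largest exact prime power divisor of \<open>n\<close>. All
  primes dividing \<open>n\<close> are at most \<open>q\<close>, so there are at most
  \<open>q\<close> of them, and each contributes a factor of at most \<open>q\<close>.\<close>

lemma large_prime_power_divisor:
  assumes "n \<ge> (2::nat)"
  obtains p k where "prime p" "p ^ k dvd n" "\<And>p'. prime p' \<Longrightarrow> p' dvd n \<Longrightarrow> p' \<le> p ^ k"
    "n \<le> (p ^ k) ^ (p ^ k)"
proof -
  let ?P = "prime_factors n" and ?f = "\<lambda>p. p ^ multiplicity p n"
  have n: "n > 0" "n \<noteq> 1" using assms by auto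
  obtain p0 where "prime p0" "p0 dvd n" using n(2) prime_factor_nat by blast
  then have "?P \<noteq> {}" using n by (auto simp: prime_factors_dvd)
  then have "Max (?f ` ?P) \<in> ?f ` ?P" by (intro Max_in) auto
  then obtain p where p: "p \<in> ?P" "?f p = Max (?f ` ?P)" by auto
  define q where "q = ?f p"
  have le_q: "?f p' \<le> q" if "p' \<in> ?P" for p'
    unfolding q_def p(2) using that by (intro Max_ge) auto
  have p'_le: "p' \<le> q" if p': "prime p'" "p' dvd n" for p'
  proof -
    have "p' \<in> ?P" using p' n by (auto simp: prime_factors_dvd)
    moreover have "multiplicity p' n > 0" using p' n by (simp add: prime_multiplicity_gt_zero_iff)
    then have "p' \<le> ?f p'" using prime_gt_0_nat[OF p'(1)] by (simp add: self_le_power)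
    ultimately show ?thesis using le_q le_trans by blast
  qed
  have "?P \<subseteq> {1..q}"
  proof
    fix x assume "x \<in> ?P"
    then have "prime x" "x dvd n" by (auto simp: prime_factors_dvd)
    then show "x \<in> {1..q}" using p'_le prime_ge_1_nat by auto
  qed
  then have "card ?P \<le> q" using card_mono[of "{1..q}" ?P] by simp
  have "q > 0" using p(1) prime_gt_0_nat[of p] by (auto simp: q_def prime_factors_dvd)
  have "n = (\<Prod>p\<in>?P. ?f p)" using n(1) by (rule prime_factorization_nat)
  also have "\<dots> \<le> (\<Prod>p\<in>?P. q)" by (intro prod_mono) (use le_q in auto)
  also have "\<dots> = q ^ card ?P" by simp
  also have "\<dots> \<le> q ^ q" using \<open>card ?P \<le> q\<close> \<open>q > 0\<close> by (intro power_increasing) auto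
  finally have "n \<le> q ^ q" .
  show ?thesis
  proof (rule that[of p "multiplicity p n"])
    show "prime p" using p(1) by (rule in_prime_factors_imp_prime)
    show "?f p dvd n" by (rule multiplicity_dvd)
  qed (use \<open>n \<le> q ^ q\<close> p'_le in \<open>simp_all only: q_def\<close>)
qed

section \<open>The Davenport constant\<close>

lemma Cyc_pow_simps:
  "n > 0 \<Longrightarrow> carrier (Cyc_pow n r) = {..<r} \<rightarrow>\<^sub>E {0..<int n}"
  "\<one>\<^bsub>Cyc_pow n r\<^esub> = (\<lambda>j\<in>{..<r}. 0)"
  "x \<otimes>\<^bsub>Cyc_pow n r\<^esub> y = (\<lambda>j\<in>{..<r}. (x j + y j) mod int n)"
  by (simp_all add: Cyc_pow_def carrier_integer_mod_group)

lemma nat_pow_Cyc_pow: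
  "g [^]\<^bsub>Cyc_pow n r\<^esub> (k::nat) = (\<lambda>j\<in>{..<r}. (int k * g j) mod int n)"
proof (induction k)
  case 0
  then show ?case by (simp add: Cyc_pow_simps)
next
  case (Suc k)
  have "g [^]\<^bsub>Cyc_pow n r\<^esub> Suc k = (\<lambda>j\<in>{..<r}. (int k * g j) mod int n) \<otimes>\<^bsub>Cyc_pow n r\<^esub> g"
    unfolding nat_pow_Suc Suc.IH ..
  also have "\<dots> = (\<lambda>j\<in>{..<r}. (int (Suc k) * g j) mod int n)"
    by (auto simp: Cyc_pow_simps(3) fun_eq_iff restrict_def mod_simps algebra_simps)
  finally show ?case .
qed

lemma finprod_Cyc_pow:
  assumes "n > 0" "finite A" "f \<in> A \<rightarrow> carrier (Cyc_pow n r)"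
  shows "finprod (Cyc_pow n r) f A = (\<lambda>j\<in>{..<r}. (\<Sum>x\<in>A. f x j) mod int n)"
  using assms(2,3)
proof (induction A rule: finite_induct)
  case empty
  interpret comm_group "Cyc_pow n r" by (rule comm_group_Cyc_pow)
  show ?case by (simp add: Cyc_pow_simps)
next
  case (insert x A)
  interpret comm_group "Cyc_pow n r" by (rule comm_group_Cyc_pow)
  have "finprod (Cyc_pow n r) f (insert x A) = f x \<otimes>\<^bsub>Cyc_pow n r\<^esub> finprod (Cyc_pow n r) f A"
    using insert by (intro finprod_insert) auto
  also have "finprod (Cyc_pow n r) f A = (\<lambda>j\<in>{..<r}. (\<Sum>x\<in>A. f x j) mod int n)"
    using insert by (intro insert.IH) auto
  also have "f x \<otimes>\<^bsub>Cyc_pow n r\<^esub> \<dots> = (\<lambda>j\<in>{..<r}. (\<Sum>x\<in>insert x A. f x j) mod int n)"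
    using insert.hyps by (auto simp: Cyc_pow_simps(3) fun_eq_iff restrict_def mod_simps)
  finally show ?case .
qed

lemma sum_count_mult:
  "(\<Sum>x\<in>set_mset M. int (count M x) * f x) = (\<Sum>x\<in>#M. f x)"
proof (induction M)
  case empty
  then show ?case by simp
next
  case (add y M)
  have "(\<Sum>x\<in>set_mset (add_mset y M). int (count (add_mset y M) x) * f x) =
      (\<Sum>x\<in>insert y (set_mset M). int (count M x) * f x + (if x = y then f x else 0))"
    by (intro sum.cong) (auto simp: algebra_simps)
  also have "\<dots> = (\<Sum>x\<in>insert y (set_mset M). int (count M x) * f x) + f y"
    by (simp only: sum.distrib) (simp add: sum.delta)
  also have "(\<Sum>x\<in>insert y (set_mset M). int (count M x) * f x) = (\<Sum>x\<in>set_mset M. int (count M x) * f x)"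
    by (cases "y \<in># M") (auto simp: insert_absorb not_in_iff)
  finally show ?case using add.IH by (simp add: add.commute)
qed

lemma zero_sum_Cyc_pow_iff:
  assumes "n > 0" "set_mset S \<subseteq> carrier (Cyc_pow n r)"
  shows "zero_sum (Cyc_pow n r) S \<longleftrightarrow> (\<forall>j<r. int n dvd (\<Sum>g\<in>#S. g j))"
proof -
  interpret comm_group "Cyc_pow n r" by (rule comm_group_Cyc_pow)
  have "seq_sum (Cyc_pow n r) S = (\<lambda>j\<in>{..<r}. (\<Sum>g\<in>set_mset S. (g [^]\<^bsub>Cyc_pow n r\<^esub> count S g) j) mod int n)"
    unfolding seq_sum_def using assms by (intro finprod_Cyc_pow) auto
  also have "\<dots> = (\<lambda>j\<in>{..<r}. (\<Sum>g\<in>#S. g j) mod int n)"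
  proof (intro restrict_ext)
    fix j assume "j \<in> {..<r}"
    then have "(\<Sum>g\<in>set_mset S. (g [^]\<^bsub>Cyc_pow n r\<^esub> count S g) j) mod int n =
       (\<Sum>g\<in>set_mset S. (int (count S g) * g j) mod int n) mod int n"
      by (simp add: nat_pow_Cyc_pow)
    also have "\<dots> = (\<Sum>g\<in>#S. g j) mod int n"
      by (simp only: mod_sum_eq sum_count_mult)
    finally show "(\<Sum>g\<in>set_mset S. (g [^]\<^bsub>Cyc_pow n r\<^esub> count S g) j) mod int n = (\<Sum>g\<in>#S. g j) mod int n" .
  qed
  finally have "zero_sum (Cyc_pow n r) S \<longleftrightarrow>
      (\<lambda>j\<in>{..<r}. (\<Sum>g\<in>#S. g j) mod int n) = (\<lambda>j\<in>{..<r}. 0)"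
    by (simp add: zero_sum_def Cyc_pow_simps(2))
  also have "\<dots> \<longleftrightarrow> (\<forall>j<r. int n dvd (\<Sum>g\<in>#S. g j))"
    by (auto simp: fun_eq_iff restrict_def dvd_eq_mod_eq_0)
  finally show ?thesis .
qed

text \<open>Listing the multiset as \<open>xs\<close> turns nonempty sets of positions into nonempty
  submultisets.\<close>

lemma davenport_le:
  assumes "n > 0" "zero_sum_bound {..<r} n l t" "t > 0"
  shows "davenport (Cyc_pow n r) \<le> t"
proof -
  have "forces_zero_sum (Cyc_pow n r) t"
    unfolding forces_zero_sum_def
  proof (intro allI impI, elim conjE)
    fix S assume S: "set_mset S \<subseteq> carrier (Cyc_pow n r)" "t \<le> size S"
    obtain xs where xs: "mset xs = S" using ex_mset by blast
    have "t \<le> card {..<length xs}" using S(2) xs by auto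
    then obtain T where T: "T \<subseteq> {..<length xs}" "T \<noteq> {}" "card T \<le> l"
      and zs: "\<And>j. j \<in> {..<r} \<Longrightarrow> int n dvd (\<Sum>i\<in>T. (xs ! i) j)"
      by (rule zero_sum_boundE[OF assms(2) finite_lessThan, where a = "(!) xs"]) blast
    define M where "M = image_mset ((!) xs) (mset_set T)"
    have finT: "finite T" using T(1) finite_subset by blast
    have "mset_set T \<subseteq># mset_set {..<length xs}" using T(1) by (intro subset_imp_msubset_mset_set) auto
    then have "M \<subseteq># image_mset ((!) xs) (mset_set {..<length xs})"
      unfolding M_def by (rule image_mset_subseteq_mono)
    also have "image_mset ((!) xs) (mset_set {..<length xs}) = mset (map ((!) xs) [0..<length xs])"
      by (simp add: lessThan_atLeast0 del: map_nth)
    also have "\<dots> = S" by (simp add: map_nth xs)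
    finally have MS: "M \<subseteq># S" .
    moreover have "M \<noteq> {#}" using T(2) finT by (simp add: M_def mset_set_empty_iff)
    moreover have "zero_sum (Cyc_pow n r) M"
    proof -
      have "(\<Sum>g\<in>#M. g j) = (\<Sum>i\<in>T. (xs ! i) j)" for j
        by (simp add: M_def sum_unfold_sum_mset multiset.map_comp comp_def)
      moreover have "set_mset M \<subseteq> carrier (Cyc_pow n r)" using set_mset_mono[OF MS] S(1) by blast
      ultimately show ?thesis using zs by (simp add: zero_sum_Cyc_pow_iff[OF assms(1)])
    qed
    ultimately show "\<exists>T. T \<subseteq># S \<and> T \<noteq> {#} \<and> zero_sum (Cyc_pow n r) T" by blast
  qed
  then show ?thesis unfolding davenport_def using assms(3) by (intro Least_le) simp
qed

text \<open>Take \<open>n - 1\<close> copies of each of the \<open>r\<close> unit vectors. If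
  \<open>e k\<close> occurs in a subsequence, coordinate \<open>k\<close> of its sum is the number
  of copies, which lies between 1 and \<open>n - 1\<close>.\<close>

lemma davenport_gt:
  assumes "n \<ge> 2"
  shows "r * (n - 1) < davenport (Cyc_pow n r)"
proof (rule ccontr)
  assume "\<not> ?thesis"
  then have small: "davenport (Cyc_pow n r) \<le> r * (n - 1)" by simp
  have forces: "forces_zero_sum (Cyc_pow n r) (davenport (Cyc_pow n r))"
    using assms by (intro davenport_wf comm_group_Cyc_pow finite_Cyc_pow) simp
  define e where "e k = (\<lambda>j\<in>{..<r}. if j = k then 1 else (0::int))" for k
  define S where "S = (\<Sum>k<r. replicate_mset (n - 1) (e k))"
  have e_inj: "e k = e k' \<longleftrightarrow> k = k'" if "k < r" "k' < r" for k k'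
  proof
    assume "e k = e k'"
    then have "e k k = e k' k" by simp
    then show "k = k'" using that by (simp add: e_def split: if_splits)
  qed simp
  have count_S: "count S (e k) = n - 1" if "k < r" for k
  proof -
    have "count S (e k) = (\<Sum>k'<r. if k' = k then n - 1 else 0)"
      unfolding S_def count_sum using that by (intro sum.cong refl) (auto simp: e_inj)
    then show ?thesis using that by simp
  qed
  have "set_mset S \<subseteq> e ` {..<r}" by (auto simp: S_def set_mset_sum split: if_splits)
  have "size S = r * (n - 1)" by (simp add: S_def size_multiset_sum)
  moreover have "e ` {..<r} \<subseteq> carrier (Cyc_pow n r)"
    using assms by (auto simp: Cyc_pow_simps e_def split: if_splits)
  ultimately obtain T where T: "T \<subseteq># S" "T \<noteq> {#}" "zero_sum (Cyc_pow n r) T"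
    using forces small subset_trans[OF \<open>set_mset S \<subseteq> e ` {..<r}\<close>] unfolding forces_zero_sum_def by metis
  have T_sub: "set_mset T \<subseteq> e ` {..<r}" using set_mset_mono[OF T(1)] \<open>set_mset S \<subseteq> e ` {..<r}\<close> by blast
  then have dvd: "int n dvd (\<Sum>g\<in>#T. g j)" if "j < r" for j
    using T(3) that \<open>e ` {..<r} \<subseteq> carrier (Cyc_pow n r)\<close> assms
    by (subst (asm) zero_sum_Cyc_pow_iff) auto
  obtain g where "g \<in># T" using T(2) by (rule multiset_nonemptyE)
  then obtain k where k: "k < r" "e k \<in># T" using T_sub by auto
  have "(\<Sum>g\<in>#T. g k) = (\<Sum>g\<in>set_mset T. int (count T g) * g k)" by (rule sum_count_mult [symmetric])
  also have "\<dots> = (\<Sum>g\<in>set_mset T. if g = e k then int (count T (e k)) else 0)"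
  proof (intro sum.cong refl)
    fix g assume "g \<in># T"
    then obtain k' where "k' < r" "g = e k'" using T_sub by auto
    moreover have "e k' k = (if k' = k then 1 else 0)" using k by (auto simp: e_def)
    ultimately show "int (count T g) * g k = (if g = e k then int (count T (e k)) else 0)"
      using e_inj k by auto
  qed
  also have "\<dots> = int (count T (e k))" using k by (simp add: sum.delta)
  finally have "int n dvd int (count T (e k))" using dvd[OF k(1)] by simp
  then have "n dvd count T (e k)" by simp
  moreover have "count T (e k) > 0" using k by simp
  ultimately have "n \<le> count T (e k)" by (rule dvd_imp_le)
  also have "\<dots> \<le> count S (e k)" using T(1) by (rule mset_subset_eq_count)
  finally show False using count_S[OF k(1)] assms by simp
qed

text \<open>The form needed for the limit: \<open>n <= q ^ q\<close> makes \<open>q\<close> tend to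
  infinity with \<open>n\<close>, and the error divided by \<open>n\<close> is of order
  \<open>l ^ r / q\<close> with \<open>l\<close> logarithmic in \<open>q\<close>.\<close>

lemma davenport_upper:
  assumes "n \<ge> 2" "r \<ge> 1"
  obtains q l where "n \<le> q ^ q" "q > 0" "l > 0" "q \<le> 2 ^ l" "2 ^ l \<le> 2 * q"
    "real (davenport (Cyc_pow n r)) \<le> real r * real n + real n * (1 + 2 * (4608 * real r * real l) ^ r) / real q"
proof -
  from assms(1) obtain p k where p: "prime p" "p ^ k dvd n" "\<And>p'. prime p' \<Longrightarrow> p' dvd n \<Longrightarrow> p' \<le> p ^ k"
    "n \<le> (p ^ k) ^ (p ^ k)"
    by (rule large_prime_power_divisor) blast
  define q where "q = p ^ k"
  obtain m where "n = p ^ k * m" using p(2) by (rule dvdE)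
  then have m: "n = m * q" by (simp add: q_def)
  have q: "q > 0" using prime_gt_0_nat[OF p(1)] by (simp add: q_def)
  have mpos: "m > 0" using m assms(1) by (intro Nat.gr0I) auto
  have nq: "n \<le> q ^ q" using p(4) by (simp only: q_def)
  have "q \<noteq> 1"
  proof
    assume "q = 1"
    then show False using nq assms(1) by simp
  qed
  \<comment> \<open>The least exponent is taken so that \<open>2 ^ l\<close> exceeds
    \<open>q\<close> by a factor of at most 2.\<close>
  define l where "l = (LEAST l. q \<le> 2 ^ l)"
  have ql: "q \<le> 2 ^ l" unfolding l_def by (rule LeastI[of _ q]) (simp add: less_imp_le)
  have l: "l > 0" using ql \<open>q \<noteq> 1\<close> q by (intro Nat.gr0I) auto
  have "\<not> q \<le> 2 ^ (l - 1)"
    using not_less_Least[of "l - 1" "\<lambda>l. q \<le> 2 ^ l"] l unfolding l_def[symmetric] by simp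
  moreover have "(2::nat) ^ l = 2 * 2 ^ (l - 1)" using l by (simp add: power_eq_if)
  ultimately have lq: "2 ^ l \<le> 2 * q" by linarith
  define g where "g = (4608 * r * l) ^ r"
  have "\<exists>l'. zero_sum_bound {..<r} (m * p ^ k) l'
           (m * (card {..<r} * (p ^ k - 1) + 1) + 2 * m * (4608 * card {..<r} * l) ^ card {..<r})"
    using assms mpos l ql p(3) m
    by (intro zero_sum_bound_large_prime_power p(1)) (auto simp: q_def)
  then obtain l' where "zero_sum_bound {..<r} n l' (m * (r * (q - 1) + 1) + 2 * m * g)"
    unfolding card_lessThan q_def[symmetric] g_def[symmetric] m by blast
  then have "davenport (Cyc_pow n r) \<le> m * (r * (q - 1) + 1) + 2 * m * g"
    using assms mpos by (intro davenport_le) auto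
  also have "\<dots> \<le> m * (r * q + 1) + 2 * m * g" by (intro add_right_mono mult_le_mono2) simp
  also have "\<dots> = r * n + m * (1 + 2 * g)" by (simp add: m algebra_simps)
  finally have "real (davenport (Cyc_pow n r)) \<le> real (r * n + m * (1 + 2 * g))" by (rule of_nat_mono)
  also have "\<dots> = real r * real n + real m * (1 + 2 * (4608 * real r * real l) ^ r)"
    by (simp add: g_def distrib_left)
  also have "real m = real n / real q" using q by (simp add: m)
  finally have "real (davenport (Cyc_pow n r)) \<le>
      real r * real n + real n * (1 + 2 * (4608 * real r * real l) ^ r) / real q" by simp
  then show ?thesis by (intro that[of q l] nq q l ql lq)
qed

theorem theorem1:
  fixes r :: nat
  assumes "r \<ge> 1"
  shows "(\<lambda>n::nat. real (davenport (Cyc_pow n r)) / (real r * real n)) \<longlonglongrightarrow> 1"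
proof (rule LIMSEQ_I)
  fix \<epsilon> :: real assume \<epsilon>: "\<epsilon> > 0"
  \<comment> \<open>This sequence dominates the relative error, since \<open>q\<close> is at least
    \<open>2 ^ l / 2\<close>.\<close>
  have "(\<lambda>l. 2 * (1 + 2 * (4608 * real r * real l) ^ r) / 2 ^ l) \<longlonglongrightarrow> 0"
  proof -
    have "(\<lambda>l. 2 * (1 / 2 ^ l) + 4 * (4608 * real r) ^ r * (real l ^ r / 2 ^ l)) \<longlonglongrightarrow> 2 * 0 + 4 * (4608 * real r) ^ r * 0"
      by (intro tendsto_intros) real_asymp+
    then show ?thesis by (simp add: power_mult_distrib add_divide_distrib algebra_simps)
  qed
  from LIMSEQ_D[OF this \<epsilon>] obtain l0 where
    l0: "\<bar>2 * (1 + 2 * (4608 * real r * real l) ^ r) / 2 ^ l\<bar> < \<epsilon>" if "l \<ge> l0" for l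
    by auto
  define Q where "Q = (2::nat) ^ l0"
  obtain N :: nat where N: "1 / \<epsilon> < real N" using reals_Archimedean2 by blast
  show "\<exists>no. \<forall>n\<ge>no. norm (real (davenport (Cyc_pow n r)) / (real r * real n) - 1) < \<epsilon>"
  proof (intro exI allI impI)
    \<comment> \<open>\<open>Q ^ Q\<close> forces \<open>q > Q\<close> and thus
      \<open>l >= l0\<close> for the upper bound; \<open>N\<close> gives
      \<open>1 / n < \<epsilon>\<close> for the lower bound; both bounds require
      \<open>n >= 2\<close>.\<close>
    fix n assume n: "n \<ge> Q ^ Q + N + 2"
    let ?D = "real (davenport (Cyc_pow n r))"
    have pos: "real r * real n > 0" using assms n by simp
    obtain q l where q: "n \<le> q ^ q" "q > 0" "l > 0" "q \<le> 2 ^ l" "2 ^ l \<le> 2 * q"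
      and D: "?D \<le> real r * real n + real n * (1 + 2 * (4608 * real r * real l) ^ r) / real q"
      using davenport_upper[of n r] n assms by auto
    have "Q < q"
    proof (rule ccontr)
      assume "\<not> Q < q"
      then have "q \<le> Q" by simp
      then have "q ^ q \<le> Q ^ q" by (rule power_mono) simp
      also have "\<dots> \<le> Q ^ Q" using \<open>q \<le> Q\<close> by (rule power_increasing) (simp add: Q_def)
      finally have "q ^ q \<le> Q ^ Q" .
      then show False using q(1) n by linarith
    qed
    then have "(2::nat) ^ l0 < 2 ^ l" using q(4) unfolding Q_def by linarith
    then have "l0 \<le> l" by simp
    let ?g = "1 + 2 * (4608 * real r * real l) ^ r"
    have g: "?g \<ge> 0" by simp
    have "?D / (real r * real n) \<le> (real r * real n + real n * ?g / real q) / (real r * real n)"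
      using D pos by (intro divide_right_mono) auto
    also have "\<dots> = 1 + ?g / (real r * real q)"
    proof -
      have eq: "(x * y + y * c / z) / (x * y) = 1 + c / (x * z)" if "x > 0" "y > 0" "z > 0" for x y z c :: real
        using that by (simp add: field_simps)
      show ?thesis by (rule eq) (use assms n q(2) in simp_all)
    qed
    also have "?g / (real r * real q) \<le> ?g / (2 ^ l / 2)"
    proof (intro divide_left_mono g)
      have "real (2 ^ l) \<le> real (2 * q)" using q(5) by (rule of_nat_mono)
      moreover have "1 * real q \<le> real r * real q" using assms by (intro mult_right_mono) auto
      ultimately show "2 ^ l / 2 \<le> real r * real q" by simp
    qed (use assms q(2) in auto)
    also have "?g / (2 ^ l / 2) = 2 * ?g / 2 ^ l" by simp
    also have "1 + 2 * ?g / 2 ^ l < 1 + \<epsilon>" using l0[OF \<open>l0 \<le> l\<close>] by linarith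
    finally have upper: "?D / (real r * real n) < 1 + \<epsilon>" by simp
    have "real (r * (n - 1)) \<le> ?D" using davenport_gt[of n r] n by (intro of_nat_mono) auto
    then have "real r * (real n - 1) / (real r * real n) \<le> ?D / (real r * real n)"
      using pos n by (intro divide_right_mono) (auto simp: of_nat_diff)
    moreover have "real r * (real n - 1) / (real r * real n) = 1 - 1 / real n"
      using assms n by (simp add: field_simps)
    moreover have "1 / real n < \<epsilon>"
    proof -
      have "1 / \<epsilon> < real n" using N n by linarith
      then show ?thesis using \<epsilon> n by (simp add: field_simps)
    qed
    ultimately have "1 - \<epsilon> < ?D / (real r * real n)" by linarith
    then show "norm (?D / (real r * real n) - 1) < \<epsilon>" using upper by (simp add: abs_less_iff)
  qed
qed

end
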